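(* Let $(u,h)$ be a smooth solution to the problem $$ \left\{ \begin{aligned} &u\cdot\nabla u+\nabla p-h\cdot\nabla h-\Delta u=0 \quad\text{in } \mathbb{R}^2\times\mathbb{T},\\ &u\cdot\nabla h-h\cdot\nabla u-\Delta h=0 \quad\text{in } \mathbb{R}^2\times\mathbb{T},\\ &\nabla\cdot u=\nabla\cdot h=0 \quad\text{in } \mathbb{R}^2\times\mathbb{T},\\ &u(x',z)=u(x',z+2\pi),\quad h(x',z)=h(x',z+2\pi),\\ &\lim_{|x|\to\infty}|u(x)|=0,\quad \lim_{|x|\to\infty}|h(x)|=0, \end{aligned} \right. $$ with finite Dirichlet integral $$\int_{\mathbb{T}}\int_{\mathbb{R}^2}|\nabla u(x)|^2\,dx+\int_{\mathbb{T}}\int_{\mathbb{R}^2}|\nabla h(x)|^2\,dx<\infty .$$ Then $u\equiv0$ and $h\equiv 0$ provided one of the following two conditions is satisfied: (i) $u^\theta\equiv0$ and $h$ is axially symmetric; (ii) both $u$ and $h$ are axially symmetric.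
   Context: This is the stationary magnetohydrodynamics system: $u(x),h(x)\in\mathbb{R}^3$ are the velocity and magnetic field and $p(x)\in\mathbb{R}$ is the scalar pressure. Here $\mathbb{T}=\mathbb{R}/2\pi\mathbb{Z}$, identified with $[-\pi,\pi]$ with endpoints identified, and points are written $x=(x_1,x_2,x_3)=(x',z)$ with $x'=(x_1,x_2)\in\mathbb{R}^2$, $z=x_3$. In $\mathbb{R}^2\times\mathbb{T}$ the limit $|x|\to\infty$ means $|x'|\to\infty$ (uniformly in $z$). Cylindrical coordinates $(r,\theta,z)$ are given by $r=\sqrt{x_1^2+x_2^2}$, $x_1=r\cos\theta$, $x_2=r\sin\theta$, $z=x_3$, with basis vectors $e_r=(x_1/r,x_2/r,0)$, $e_\theta=(-x_2/r,x_1/r,0)$, $e_z=(0,0,1)$. A vector field $v$ is written $v=v^r e_r+v^\theta e_\theta+v^z e_z$, where the components are functions of $(r,\theta,z)$; $u^\theta$ is the angular (swirl) component of $u$. The vector field $v$ is called axially symmetric if $\partial_\theta v^r=\partial_\theta v^\theta=\partial_\theta v^z\equiv0$, i.e. its three cylindrical components depend only on $(r,z)$. *)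

theory Defs
  imports "HOL-Analysis.Analysis"
begin

definition partial :: "3 \<Rightarrow> (real^3 \<Rightarrow> 'a::real_normed_vector) \<Rightarrow> real^3 \<Rightarrow> 'a" where
  "partial i f x = frechet_derivative f (at x) (axis i 1)"

fun times_cont_differentiable :: "nat \<Rightarrow> (real^3 \<Rightarrow> 'a::real_normed_vector) \<Rightarrow> bool" where
  "times_cont_differentiable 0 f \<longleftrightarrow> continuous_on UNIV f"
| "times_cont_differentiable (Suc n) f \<longleftrightarrow>
     f differentiable_on UNIV \<and> (\<forall>i. times_cont_differentiable n (partial i f))"

definition smooth :: "(real^3 \<Rightarrow> 'a::real_normed_vector) \<Rightarrow> bool" where
  "smooth f \<longleftrightarrow> (\<forall>n. times_cont_differentiable n f)"

definition gradient :: "(real^3 \<Rightarrow> real) \<Rightarrow> real^3 \<Rightarrow> real^3" where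
  "gradient p x = (\<chi> i. partial i p x)"

definition divergence :: "(real^3 \<Rightarrow> real^3) \<Rightarrow> real^3 \<Rightarrow> real" where
  "divergence v x = (\<Sum>i\<in>UNIV. partial i (\<lambda>y. v y $ i) x)"

definition laplacian :: "(real^3 \<Rightarrow> 'a::real_normed_vector) \<Rightarrow> real^3 \<Rightarrow> 'a" where
  "laplacian f x = (\<Sum>i\<in>UNIV. partial i (partial i f) x)"

definition convection :: "(real^3 \<Rightarrow> real^3) \<Rightarrow> (real^3 \<Rightarrow> real^3) \<Rightarrow> real^3 \<Rightarrow> real^3" where
  \<comment> \<open>\<open>w \<cdot> \<nabla>v\<close>\<close>
  "convection w v x = (\<Sum>i\<in>UNIV. (w x $ i) *\<^sub>R partial i v x)"

definition periodic_z :: "(real^3 \<Rightarrow> 'a) \<Rightarrow> bool" where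
  "periodic_z f \<longleftrightarrow> (\<forall>x. f (x + axis 3 (2 * pi)) = f x)"

text \<open>
  Functions on \<open>\<real>\<^sup>2 \<times> \<T>\<close> are functions on \<open>\<real>\<^sup>3\<close> that are \<open>2\<pi>\<close>-periodic in the third variable;
  integrals over \<open>\<real>\<^sup>2 \<times> \<T>\<close> are taken over the period cell below.
\<close>

definition cell :: "(real^3) set" where
  "cell = {x. - pi \<le> x $ 3 \<and> x $ 3 \<le> pi}"

definition dirichlet_integral :: "(real^3 \<Rightarrow> real^3) \<Rightarrow> ennreal" where
  "dirichlet_integral v =
     (\<integral>\<^sup>+x\<in>cell. ennreal (\<Sum>i\<in>UNIV. (norm (partial i v x))\<^sup>2) \<partial>lborel)"

definition radius :: "real^3 \<Rightarrow> real" where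
  "radius x = sqrt ((x $ 1)\<^sup>2 + (x $ 2)\<^sup>2)"

text \<open>The filter expressing \<open>\<bar>x'\<bar> \<rightarrow> \<infinity>\<close>; limits along it are uniform in \<open>z\<close>.\<close>

definition horizontal_infinity :: "(real^3) filter" where
  "horizontal_infinity = filtercomap radius at_top"

text \<open>The vectors \<open>e_r\<close> and \<open>e_theta\<close> are meaningful only off the axis, where \<open>radius x > 0\<close>.\<close>

definition e_r :: "real^3 \<Rightarrow> real^3" where
  "e_r x = vector [x $ 1 / radius x, x $ 2 / radius x, 0]"

definition e_theta :: "real^3 \<Rightarrow> real^3" where
  "e_theta x = vector [- (x $ 2) / radius x, x $ 1 / radius x, 0]"

definition e_z :: "real^3 \<Rightarrow> real^3" where
  "e_z x = vector [0, 0, 1]"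

text \<open>
  The frame is orthonormal, so the coefficient of \<open>v\<close> along one of its members \<open>e\<close>
  is the inner product of the two.
\<close>

definition component :: "(real^3 \<Rightarrow> real^3) \<Rightarrow> (real^3 \<Rightarrow> real^3) \<Rightarrow> real^3 \<Rightarrow> real" where
  "component e v x = v x \<bullet> e x"

definition cyl :: "real \<Rightarrow> real \<Rightarrow> real \<Rightarrow> real^3" where
  "cyl r \<theta> z = vector [r * cos \<theta>, r * sin \<theta>, z]"

definition axially_symmetric :: "(real^3 \<Rightarrow> real^3) \<Rightarrow> bool" where
  "axially_symmetric v \<longleftrightarrow>
     (\<forall>e\<in>{e_r, e_theta, e_z}. \<forall>r>0. \<forall>\<theta> z.
        ((\<lambda>t. component e v (cyl r t z)) has_real_derivative 0) (at \<theta>))"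

definition swirl_free :: "(real^3 \<Rightarrow> real^3) \<Rightarrow> bool" where
  "swirl_free v \<longleftrightarrow> (\<forall>x. radius x > 0 \<longrightarrow> component e_theta v x = 0)"

end

theory Submission
  imports Defs
begin

text \<open>
  The proof is a Caccioppoli estimate on the slabs \<open>[-R, R]\<^sup>2 \<times> [-\<pi>, \<pi>]\<close>. Test the momentum
  equation with \<open>\<phi> u\<close> and the induction equation with \<open>\<phi> h\<close>, where \<open>\<phi>\<close> is a cut-off
  depending only on \<open>\<bar>x'\<bar> / R\<close>, and add. The Lorentz terms combine into a divergence, and
  \<open>\<integral> \<phi> (\<bar>\<nabla>u\<bar>\<^sup>2 + \<bar>\<nabla>h\<bar>\<^sup>2)\<close> becomes an integral of fluxes against \<open>\<nabla>\<phi>\<close>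
  (\<open>energy_identity\<close>). As \<open>\<nabla>\<phi>\<close> is radial, of size \<open>1 / R\<close>, every convective or pressure flux
  carries one of the radial moments \<open>x' \<cdot> u'\<close> and \<open>x' \<cdot> h'\<close> as a factor. Since the slab has
  volume of order \<open>R\<^sup>2\<close>, boundedness of the fields alone leaves these fluxes of order \<open>R\<close>, and
  says nothing about the pressure.

  The gain comes from symmetry. Either alternative of the hypothesis gives
  \<open>\<partial>\<^sub>\<theta> u\<^sup>\<theta> = \<partial>\<^sub>\<theta> h\<^sup>\<theta> = 0\<close>, so both cases run in parallel. For a solenoidal field \<open>v\<close> with
  this property, \<open>r \<partial>\<^sub>r (r v\<^sup>r) = - r\<^sup>2 \<partial>\<^sub>z v\<^sup>z\<close>, so the integral of \<open>r v\<^sup>r = x' \<cdot> v'\<close> over a vertical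
  period is constant along rays and vanishes on the axis: it is zero (\<open>primitive_radial_top\<close>).
  The Poincare inequality on vertical segments then gives
  \<open>\<parallel>x' \<cdot> v'\<parallel> \<le> C R \<parallel>\<nabla>v\<parallel>\<close> in \<open>L\<^sup>2\<close> of the slab (\<open>radial_L2\<close>), where boundedness alone
  would give order \<open>R\<^sup>2\<close>. With Young's inequality, the convective and diffusive fluxes are
  at most \<open>C \<delta> + C / (\<delta> R\<^sup>2) \<integral> (\<bar>u\<bar>\<^sup>2 + \<bar>h\<bar>\<^sup>2)\<close> for every \<open>\<delta> > 0\<close>, and the average in the
  last term tends to zero because the fields decay.

  For the pressure, write \<open>x' \<cdot> u' = \<partial>\<^sub>z w\<close> with a stream function \<open>w\<close> vanishing at the top and
  the bottom of the slab. Integrating by parts in \<open>z\<close> turns the pressure into \<open>\<partial>\<^sub>z p\<close>, which the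
  third momentum equation expresses through \<open>\<Delta>u\<^sup>z\<close> and quadratic terms; a further integration by
  parts removes the second derivatives (\<open>pressure_test\<close>). With the factor \<open>R\<^sup>-\<^sup>2\<close> from \<open>\<nabla>\<phi>\<close>,
  the pressure flux is \<open>O(1 / R)\<close> (\<open>pressure_flux_le\<close>). Periodicity of \<open>p\<close>, needed for the
  energy identity, follows from the equations as well: \<open>\<nabla>p\<close> is periodic, so \<open>p\<close> is periodic up to a linear function \<open>c z\<close>, and testing
  the third equation with a cut-off shows \<open>\<bar>c\<bar> R\<^sup>2 \<le> C R\<close> (\<open>pressure_periodic\<close>).

  Letting \<open>R \<rightarrow> \<infinity>\<close> and then \<open>\<delta> \<rightarrow> 0\<close> yields \<open>\<nabla>u = \<nabla>h = 0\<close>, and the decay forces \<open>u = h = 0\<close>.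
\<close>

section \<open>Partial derivatives along coordinate lines\<close>

text \<open>
  Differentiability along one coordinate direction only. Every integration by parts and every
  slice inequality below takes place along a single coordinate, and the vertical primitives
  constructed later are most easily differentiated in one coordinate at a time.
\<close>

definition has_partial :: "3 \<Rightarrow> (real^3 \<Rightarrow> real) \<Rightarrow> (real^3 \<Rightarrow> real) \<Rightarrow> bool" where
  "has_partial i f g \<longleftrightarrow>
     (\<forall>x. ((\<lambda>t. f (x + t *\<^sub>R axis i 1)) has_real_derivative g x) (at 0))"

lemma has_partial_along_line:
  assumes "has_partial i f g"
  shows "((\<lambda>t. f (x + t *\<^sub>R axis i 1)) has_real_derivative g (x + t *\<^sub>R axis i 1)) (at t)"
proof -
  have "((\<lambda>s. f ((x + t *\<^sub>R axis i 1) + s *\<^sub>R axis i 1))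
      has_real_derivative g (x + t *\<^sub>R axis i 1)) (at 0)"
    using assms by (simp add: has_partial_def)
  then have "((\<lambda>s. f (x + (s + t) *\<^sub>R axis i 1))
      has_real_derivative g (x + t *\<^sub>R axis i 1)) (at 0)"
    by (simp add: scaleR_add_left add_ac)
  then show ?thesis
    using DERIV_shift[of "\<lambda>s. f (x + s *\<^sub>R axis i 1)" _ 0 t] by simp
qed

lemma has_partial_const: "has_partial i (\<lambda>x. c) (\<lambda>x. 0)"
  by (simp add: has_partial_def)

lemma has_partial_coord: "has_partial i (\<lambda>x. x $ j) (\<lambda>x. if j = i then 1 else 0)"
  unfolding has_partial_def
  by (auto simp: axis_def intro!: derivative_eq_intros)

lemma has_partial_add:
  "has_partial i f f' \<Longrightarrow> has_partial i g g' \<Longrightarrow> has_partial i (\<lambda>x. f x + g x) (\<lambda>x. f' x + g' x)"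
  by (auto simp: has_partial_def intro: DERIV_add)

lemma has_partial_diff:
  "has_partial i f f' \<Longrightarrow> has_partial i g g' \<Longrightarrow> has_partial i (\<lambda>x. f x - g x) (\<lambda>x. f' x - g' x)"
  by (auto simp: has_partial_def intro: DERIV_diff)

lemma has_partial_mult:
  assumes "has_partial i f f'" "has_partial i g g'"
  shows "has_partial i (\<lambda>x. f x * g x) (\<lambda>x. f' x * g x + f x * g' x)"
  unfolding has_partial_def
proof
  fix x
  show "((\<lambda>t. f (x + t *\<^sub>R axis i 1) * g (x + t *\<^sub>R axis i 1)) has_real_derivative
          f' x * g x + f x * g' x) (at 0)"
    using DERIV_mult[of "\<lambda>t. f (x + t *\<^sub>R axis i 1)" "f' x" 0 UNIV
        "\<lambda>t. g (x + t *\<^sub>R axis i 1)" "g' x"] assms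
    by (simp add: has_partial_def algebra_simps)
qed

lemma has_partial_cmult:
  "has_partial i f f' \<Longrightarrow> has_partial i (\<lambda>x. c * f x) (\<lambda>x. c * f' x)"
  using has_partial_mult[OF has_partial_const[of i c]] by simp

lemma has_partial_sum:
  "(\<And>k. k \<in> A \<Longrightarrow> has_partial i (f k) (f' k)) \<Longrightarrow>
     has_partial i (\<lambda>x. \<Sum>k\<in>A. f k x) (\<lambda>x. \<Sum>k\<in>A. f' k x)"
  unfolding has_partial_def by (auto intro!: DERIV_sum)

lemma has_partial_compose:
  assumes "\<And>s. (F has_real_derivative F' s) (at s)" "has_partial i f f'"
  shows "has_partial i (\<lambda>x. F (f x)) (\<lambda>x. F' (f x) * f' x)"
  unfolding has_partial_def
proof
  fix x
  show "((\<lambda>t. F (f (x + t *\<^sub>R axis i 1))) has_real_derivative F' (f x) * f' x) (at 0)"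
    using assms(2) DERIV_chain2[of F "F' (f x)" "\<lambda>t. f (x + t *\<^sub>R axis i 1)" 0 "f' x" UNIV]
      assms(1)[of "f x"]
    by (simp add: has_partial_def)
qed

lemma has_partial_unique:
  "has_partial i f g \<Longrightarrow> has_partial i f g' \<Longrightarrow> g = g'"
  unfolding has_partial_def by (metis DERIV_unique ext)

lemma has_partial_frechet:
  fixes f :: "real^3 \<Rightarrow> 'a::real_normed_vector"
  assumes "f differentiable_on UNIV"
  shows "((\<lambda>t. f (x + t *\<^sub>R axis i 1)) has_vector_derivative partial i f x) (at 0)"
proof -
  have d: "(f has_derivative frechet_derivative f (at x)) (at x)"
    using assms by (simp add: differentiable_on_def frechet_derivative_works)
  have "((\<lambda>t. f (x + t *\<^sub>R axis i 1)) has_derivative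
      (\<lambda>t. frechet_derivative f (at x) (t *\<^sub>R axis i 1))) (at 0)"
    by (rule has_derivative_compose[where g = f and f = "\<lambda>t. x + t *\<^sub>R axis i 1" and x=0])
      (auto intro!: derivative_eq_intros d)
  then show ?thesis
    using has_derivative_linear[OF d]
    by (simp add: has_vector_derivative_def partial_def linear_scale)
qed

section \<open>Integration over boxes, one coordinate at a time\<close>

lemma coordinates_exhaust:
  fixes i j k :: 3
  assumes "i \<noteq> j" "j \<noteq> k" "i \<noteq> k"
  shows "l = i \<or> l = j \<or> l = k"
proof -
  have "card {i, j, k} = CARD(3)" using assms by simp
  then have "{i, j, k} = UNIV" by (intro card_subset_eq) auto
  then show ?thesis by blast
qed

lemma remaining_coordinates:
  fixes i :: 3
  obtains j k where "i \<noteq> j" "j \<noteq> k" "i \<noteq> k"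
proof (cases i rule: exhaust_3[THEN disjE])
  case 1 then show ?thesis using that[of 2 3] by simp
next
  case 2
  then show ?thesis
  proof
    assume "i = 2" then show ?thesis using that[of 1 3] by simp
  next
    assume "i = 3" then show ?thesis using that[of 1 2] by simp
  qed
qed

definition transversal :: "3 \<Rightarrow> 3 \<Rightarrow> real \<times> real \<Rightarrow> real^3" where
  "transversal j k q = fst q *\<^sub>R axis j 1 + snd q *\<^sub>R axis k 1"

text \<open>
  Fubini's theorem with an arbitrary choice of the inner coordinate \<open>i\<close>: the coordinate change
  that separates \<open>x\<^sub>i\<close> from the two others maps boxes to boxes and preserves their volume, and on a
  product of two factors the integral of a continuous function is an iterated one.
\<close>

lemma integral_cbox_slices:
  fixes f :: "real^3 \<Rightarrow> real"
  assumes ijk: "i \<noteq> j" "j \<noteq> k" "i \<noteq> k" and f: "continuous_on UNIV f"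
  shows "integral (cbox a b) f =
    integral (cbox (a $ j, a $ k) (b $ j, b $ k))
      (\<lambda>q. integral {a $ i..b $ i} (\<lambda>s. f (transversal j k q + s *\<^sub>R axis i 1)))"
proof -
  define T where "T = (\<lambda>(q, s). transversal j k q + s *\<^sub>R axis i (1::real))"
  define S where "S = (\<lambda>x::real^3. ((x $ j, x $ k), x $ i))"
  have T: "T (q, s) $ l = (if l = i then s else if l = j then fst q else snd q)" for q s l
    using ijk coordinates_exhaust[OF ijk, of l]
    by (auto simp: T_def transversal_def axis_def)
  have ST: "S (T y) = y" for y
    using ijk by (cases y) (auto simp: S_def T)
  have TS: "T (S x) = x" for x
    using coordinates_exhaust[OF ijk] ijk by (auto simp: vec_eq_iff S_def T)
  have mem: "x \<in> cbox u v \<longleftrightarrow> S x \<in> cbox (S u) (S v)" for x u v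
  proof -
    have "(\<forall>l. u $ l \<le> x $ l \<and> x $ l \<le> v $ l) \<longleftrightarrow>
       (\<forall>l\<in>{i, j, k}. u $ l \<le> x $ l \<and> x $ l \<le> v $ l)"
      using coordinates_exhaust[OF ijk] by blast
    then show ?thesis
      by (auto simp: mem_box_cart S_def cbox_Pair_eq)
  qed
  have imT: "T ` cbox u v = cbox (T u) (T v)" for u v
  proof -
    have "x \<in> T ` cbox u v \<longleftrightarrow> S x \<in> cbox u v" for x
      using TS[of x] ST by force
    then show ?thesis
      unfolding set_eq_iff using mem[of _ "T u" "T v"] by (simp add: ST)
  qed
  have imS: "S ` cbox u v = cbox (S u) (S v)" for u v
  proof -
    have "y \<in> S ` cbox u v \<longleftrightarrow> T y \<in> cbox u v" for y
      using ST[of y] TS by force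
    then show ?thesis
      unfolding set_eq_iff using mem[of "T _" u v] by (simp add: ST)
  qed
  have UN: "UNIV = {i, j, k}" using coordinates_exhaust[OF ijk] by auto
  have con: "measure lborel (T ` cbox u v) = measure lborel (cbox u v)" for u v
  proof (cases "cbox u v = {}")
    case False
    then have ne: "cbox (T u) (T v) \<noteq> {}" using imT[of u v] by blast
    obtain p s q t where uv: "u = (p, s)" "v = (q, t)" by (metis surj_pair)
    have "measure lborel (cbox u v) = measure lborel (cbox p q) * measure lborel (cbox s t)"
      by (simp add: uv content_Pair)
    moreover have "measure lborel (cbox p q) = (fst q - fst p) * (snd q - snd p)" "measure lborel (cbox s t) = t - s"
    proof -
      have *: "cbox p q \<noteq> {}" "cbox s t \<noteq> {}" using False uv by (auto simp: cbox_Pair_eq)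
      have "fst p \<le> fst q" "snd p \<le> snd q" "s \<le> t"
        using * by (auto simp: cbox_Pair_eq[of "fst p" "snd p" "fst q" "snd q", simplified])
      then show "measure lborel (cbox p q) = (fst q - fst p) * (snd q - snd p)" "measure lborel (cbox s t) = t - s"
        using content_Pair[of "fst p" "snd p" "fst q" "snd q"] by auto
    qed
    moreover have "measure lborel (cbox (T u) (T v)) = (\<Prod>l\<in>UNIV. T v $ l - T u $ l)"
      by (rule content_cbox_cart[OF ne])
    ultimately show ?thesis using ijk
      by (simp add: imT uv UN T)
  qed simp
  have contT: "continuous_on UNIV T"
    unfolding T_def transversal_def split_beta by (intro continuous_intros)
  have "((\<lambda>x. f (T x)) has_integral (1 / 1) *\<^sub>R integral (cbox a b) f) (S ` cbox a b)"
  proof (rule has_integral_twiddle)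
    show "continuous (at x) T" for x
      using contT continuous_on_eq_continuous_at[of UNIV T] by (simp only: open_UNIV UNIV_I)
    show "(f has_integral integral (cbox a b) f) (cbox a b)"
      by (intro integrable_integral integrable_continuous continuous_on_subset[OF f]) simp
    show "\<exists>w z. T ` cbox u v = cbox w z" "\<exists>w z. S ` cbox u' v' = cbox w z" for u v u' v'
      using imT imS by blast+
  qed (simp_all add: ST TS con)
  then have "integral (cbox a b) f = integral (cbox (S a) (S b)) (\<lambda>x. f (T x))"
    by (simp add: imS integral_unique)
  also have "\<dots> = integral (cbox (a $ j, a $ k) (b $ j, b $ k))
      (\<lambda>q. integral (cbox (a $ i) (b $ i)) (\<lambda>s. f (T (q, s))))"
    unfolding S_def
    by (rule integral_prod_continuous)
      (intro continuous_on_compose2[OF f] continuous_on_subset[OF contT]; simp)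
  finally show ?thesis by (simp add: T_def)
qed

lemma continuous_on_line:
  assumes "continuous_on UNIV f"
  shows "continuous_on A (\<lambda>s. f (x + s *\<^sub>R axis i (1::real)))"
  by (intro continuous_on_compose2[OF assms] continuous_intros) auto

text \<open>
  The divergence theorem for one coordinate. Equality of \<open>F\<close> on opposite faces covers both the
  sides, where a cut-off vanishes, and the top and bottom, where \<open>F\<close> is periodic.
\<close>

lemma integral_partial_zero:
  assumes D: "has_partial i F g" and g: "continuous_on UNIV g" and ab: "a $ i \<le> b $ i"
    and faces: "\<And>x. x $ i = a $ i \<Longrightarrow> F (x + (b $ i - a $ i) *\<^sub>R axis i 1) = F x"
  shows "integral (cbox a b) g = 0"
proof -
  obtain j k where ijk: "i \<noteq> j" "j \<noteq> k" "i \<noteq> k" by (rule remaining_coordinates)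
  have "integral {a $ i..b $ i} (\<lambda>s. g (transversal j k q + s *\<^sub>R axis i 1)) = 0" for q
  proof -
    let ?x = "transversal j k q"
    have "((\<lambda>s. g (?x + s *\<^sub>R axis i 1)) has_integral
        F (?x + (b $ i) *\<^sub>R axis i 1) - F (?x + (a $ i) *\<^sub>R axis i 1)) {a $ i..b $ i}"
      by (rule fundamental_theorem_of_calculus[OF ab])
        (metis D has_partial_along_line has_real_derivative_iff_has_vector_derivative
           has_vector_derivative_at_within)
    moreover have "F (?x + (b $ i) *\<^sub>R axis i 1) = F (?x + (a $ i) *\<^sub>R axis i 1)"
      using faces[of "?x + (a $ i) *\<^sub>R axis i 1"] ijk
      by (simp add: transversal_def axis_def algebra_simps)
    ultimately show ?thesis by (simp add: integral_unique)
  qed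
  then show ?thesis
    by (simp add: integral_cbox_slices[OF ijk g])
qed

section \<open>A Poincare inequality on slices\<close>

text \<open>
  Cauchy--Schwarz for \<open>f t - f s = \<integral> g\<close>, obtained from \<open>0 \<le> \<integral> (g - m)\<^sup>2\<close> with \<open>m\<close> the mean of \<open>g\<close>.
\<close>

lemma square_increment_le:
  fixes f g :: "real \<Rightarrow> real"
  assumes D: "\<And>t. (f has_real_derivative g t) (at t)" and g: "continuous_on UNIV g"
    and s: "s \<in> {a..b}" and t: "t \<in> {a..b}"
  shows "(f t - f s)\<^sup>2 \<le> (b - a) * integral {a..b} (\<lambda>r. (g r)\<^sup>2)"
proof -
  have cg: "continuous_on A g" for A using g continuous_on_subset by blast
  have I: "(\<lambda>r. (g r)\<^sup>2) integrable_on {c..d}" for c d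
    by (intro integrable_continuous_real continuous_intros cg)
  have main: "(f d - f c)\<^sup>2 \<le> (b - a) * integral {a..b} (\<lambda>r. (g r)\<^sup>2)"
    if "c \<le> d" "{c..d} \<subseteq> {a..b}" for c d
  proof (cases "c = d")
    case True
    have "0 \<le> integral {a..b} (\<lambda>r. (g r)\<^sup>2)" by (intro integral_nonneg I) auto
    moreover have "a \<le> b" using s by simp
    ultimately show ?thesis using True by simp
  next
    case False
    then have cd: "c < d" using that by simp
    define k where "k = f d - f c"
    \<comment> \<open>the minimiser of \<open>\<integral> (g - m)\<^sup>2\<close>\<close>
    define m where "m = k / (d - c)"
    have FT: "(g has_integral k) {c..d}" unfolding k_def
      by (rule fundamental_theorem_of_calculus[OF that(1)])
        (metis D has_real_derivative_iff_has_vector_derivative has_vector_derivative_at_within)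
    have "((\<lambda>r. (g r)\<^sup>2 - 2 * m * g r + m\<^sup>2) has_integral
        integral {c..d} (\<lambda>r. (g r)\<^sup>2) - 2 * m * k + (d - c) *\<^sub>R m\<^sup>2) {c..d}"
      using cd by (intro has_integral_add has_integral_diff has_integral_mult_right FT
            has_integral_const_real[THEN has_integral_eq_rhs] integrable_integral I) auto
    then have "0 \<le> integral {c..d} (\<lambda>r. (g r)\<^sup>2) - 2 * m * k + (d - c) *\<^sub>R m\<^sup>2"
    proof (rule has_integral_nonneg)
      fix r
      have "(g r)\<^sup>2 - 2 * m * g r + m\<^sup>2 = (g r - m)\<^sup>2"
        by (simp add: power2_diff)
      then show "0 \<le> (g r)\<^sup>2 - 2 * m * g r + m\<^sup>2" by simp
    qed
    then have "k\<^sup>2 / (d - c) \<le> integral {c..d} (\<lambda>r. (g r)\<^sup>2)"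
      using cd by (simp add: m_def power2_eq_square)
    also have "\<dots> \<le> integral {a..b} (\<lambda>r. (g r)\<^sup>2)"
      by (rule integral_subset_le[OF that(2) I I]) auto
    finally have "k\<^sup>2 \<le> (d - c) * integral {a..b} (\<lambda>r. (g r)\<^sup>2)"
      using cd by (simp add: field_simps)
    also have "\<dots> \<le> (b - a) * integral {a..b} (\<lambda>r. (g r)\<^sup>2)"
      using that cd by (intro mult_right_mono integral_nonneg I) auto
    finally show ?thesis by (simp add: k_def)
  qed
  show ?thesis
    using main[of s t] main[of t s] s t by (cases "s \<le> t") (auto simp: power2_commute)
qed

text \<open>
  On every line in direction \<open>i\<close>, the increment of \<open>f\<close> from a zero on that line is bounded by the
  slice integral of \<open>g\<^sup>2\<close> times \<open>b\<^sub>i - a\<^sub>i\<close>. Integrating this constant bound over the slice gives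
  the second factor \<open>b\<^sub>i - a\<^sub>i\<close>, and integrating over the lines gives the claim.
\<close>

lemma poincare_slices:
  assumes D: "has_partial i f g" and f: "continuous_on UNIV f" and g: "continuous_on UNIV g"
    and zero: "\<And>x. \<exists>s\<in>{a $ i..b $ i}. f (x + (s - x $ i) *\<^sub>R axis i 1) = 0"
  shows "integral (cbox a b) (\<lambda>x. (f x)\<^sup>2) \<le> (b $ i - a $ i)\<^sup>2 * integral (cbox a b) (\<lambda>x. (g x)\<^sup>2)"
proof -
  obtain j k where ijk: "i \<noteq> j" "j \<noteq> k" "i \<noteq> k" by (rule remaining_coordinates)
  let ?L = "b $ i - a $ i"
  let ?I = "\<lambda>h :: real^3 \<Rightarrow> real. \<lambda>q. integral {a $ i..b $ i} (\<lambda>s. (h (transversal j k q + s *\<^sub>R axis i (1::real)))\<^sup>2)"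
  have L: "0 \<le> ?L" using zero[of 0] by auto
  have slice: "?I f q \<le> ?L\<^sup>2 * ?I g q" for q
  proof -
    let ?x = "transversal j k q"
    obtain s where s: "s \<in> {a $ i..b $ i}" "f (?x + s *\<^sub>R axis i 1) = 0"
      using zero[of ?x] ijk by (auto simp: transversal_def axis_def)
    have "(f (?x + t *\<^sub>R axis i 1))\<^sup>2 \<le> ?L * ?I g q" if "t \<in> {a $ i..b $ i}" for t
      using square_increment_le[OF has_partial_along_line[OF D, of ?x] continuous_on_line[OF g] s(1) that]
        s(2) by simp
    then have "?I f q \<le> integral {a $ i..b $ i} (\<lambda>t. ?L * ?I g q)"
      by (intro integral_le integrable_continuous_real continuous_intros continuous_on_line f) auto
    then show ?thesis using L by (simp add: power2_eq_square)
  qed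
  have cI: "continuous_on UNIV (?I h)" if h: "continuous_on UNIV h" for h :: "real^3 \<Rightarrow> real"
  proof -
    have "continuous_on (UNIV \<times> cbox (a $ i) (b $ i))
       (\<lambda>(q, s). (h (transversal j k q + s *\<^sub>R axis i (1::real)))\<^sup>2)"
      unfolding transversal_def split_beta
      by (rule continuous_on_power[OF continuous_on_compose2[OF h _ subset_UNIV]])
        (intro continuous_intros)
    from integral_continuous_on_param[OF this] show ?thesis by simp
  qed
  have iI: "(?I h) integrable_on cbox c d" if "continuous_on UNIV h" for h c d
    using cI[OF that] by (meson continuous_on_subset integrable_continuous subset_UNIV)
  have "integral (cbox a b) (\<lambda>x. (f x)\<^sup>2) = integral (cbox (a $ j, a $ k) (b $ j, b $ k)) (?I f)"
    by (intro integral_cbox_slices ijk continuous_intros f)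
  also have "\<dots> \<le> integral (cbox (a $ j, a $ k) (b $ j, b $ k)) (\<lambda>q. ?L\<^sup>2 * ?I g q)"
    by (intro integral_le iI f slice integrable_on_mult_right g)
  also have "\<dots> = ?L\<^sup>2 * integral (cbox (a $ j, a $ k) (b $ j, b $ k)) (?I g)"
    by simp
  also have "\<dots> = ?L\<^sup>2 * integral (cbox a b) (\<lambda>x. (g x)\<^sup>2)"
    by (subst integral_cbox_slices[OF ijk]) (auto intro!: continuous_intros g)
  finally show ?thesis .
qed

section \<open>Components of smooth fields\<close>

lemma smooth_partial: "smooth f \<Longrightarrow> smooth (partial i f)"
  unfolding smooth_def by (metis times_cont_differentiable.simps(2))

lemma smooth_differentiable: "smooth f \<Longrightarrow> f differentiable_on UNIV"
  unfolding smooth_def using times_cont_differentiable.simps(2) by blast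

lemma smooth_continuous: "smooth f \<Longrightarrow> continuous_on UNIV f"
  unfolding smooth_def using times_cont_differentiable.simps(1) by blast

lemma continuous_component:
  fixes f :: "real^3 \<Rightarrow> real^3"
  shows "smooth f \<Longrightarrow> continuous_on UNIV (\<lambda>x. f x $ k)"
  by (intro continuous_intros smooth_continuous)

lemma has_partial_smooth:
  fixes f :: "real^3 \<Rightarrow> real"
  assumes "smooth f"
  shows "has_partial i f (partial i f)"
  using has_partial_frechet[OF smooth_differentiable[OF assms]]
  by (simp add: has_partial_def has_real_derivative_iff_has_vector_derivative)

lemma has_partial_component:
  fixes f :: "real^3 \<Rightarrow> real^3"
  assumes "smooth f"
  shows "has_partial i (\<lambda>x. f x $ k) (\<lambda>x. partial i f x $ k)"
  unfolding has_partial_def has_real_derivative_iff_has_vector_derivative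
  by (intro allI bounded_linear.has_vector_derivative[OF bounded_linear_vec_nth]
      has_partial_frechet smooth_differentiable assms)

lemma partial_component:
  fixes f :: "real^3 \<Rightarrow> real^3"
  assumes "smooth f"
  shows "partial i (\<lambda>y. f y $ k) x = partial i f x $ k"
proof -
  have "(\<lambda>y. f y $ k) differentiable_on UNIV"
    unfolding differentiable_on_def
  proof
    fix x
    have "(f has_derivative frechet_derivative f (at x)) (at x)"
      using smooth_differentiable[OF assms]
      by (simp add: differentiable_on_def frechet_derivative_works)
    from bounded_linear.has_derivative[OF bounded_linear_vec_nth this]
    show "(\<lambda>y. f y $ k) differentiable at x"
      by (rule differentiableI)
  qed
  then have "has_partial i (\<lambda>y. f y $ k) (partial i (\<lambda>y. f y $ k))"
    using has_partial_frechet[of "\<lambda>y. f y $ k" _ i]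
    by (simp add: has_partial_def has_real_derivative_iff_has_vector_derivative)
  then show ?thesis
    using has_partial_unique[OF _ has_partial_component[OF assms]] by metis
qed

lemma divergence_components:
  "smooth v \<Longrightarrow> divergence v x = partial 1 v x $ 1 + partial 2 v x $ 2 + partial 3 v x $ 3"
  by (simp add: divergence_def partial_component sum_3)

lemma chain_rule_component:
  fixes v :: "real^3 \<Rightarrow> real^3"
  assumes v: "smooth v" and c: "(c has_vector_derivative c') (at t)"
  shows "((\<lambda>t. v (c t) $ k) has_real_derivative (\<Sum>i\<in>UNIV. c' $ i * partial i v (c t) $ k)) (at t)"
proof -
  let ?D = "frechet_derivative v (at (c t))"
  have dv: "(v has_derivative ?D) (at (c t))"
    using smooth_differentiable[OF v] by (simp add: differentiable_on_def frechet_derivative_works)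
  have lin: "linear ?D" using dv by (rule has_derivative_linear)
  have "c' = (\<Sum>i\<in>UNIV. c' $ i *\<^sub>R axis i 1)"
    using basis_expansion[of c'] by (simp add: scalar_mult_eq_scaleR)
  then have "?D c' = ?D (\<Sum>i\<in>UNIV. c' $ i *\<^sub>R axis i 1)"
    by (rule arg_cong)
  also have "\<dots> = (\<Sum>i\<in>UNIV. c' $ i *\<^sub>R partial i v (c t))"
    by (simp add: linear_sum[OF lin] linear_scale[OF lin] partial_def)
  finally have D: "?D c' = (\<Sum>i\<in>UNIV. c' $ i *\<^sub>R partial i v (c t))" .
  have "((\<lambda>t. v (c t)) has_vector_derivative ?D c') (at t)"
    using vector_derivative_diff_chain_within[OF c, of v ?D] dv
    by (simp add: o_def has_derivative_at_withinI)
  then have "((\<lambda>t. v (c t) $ k) has_vector_derivative ?D c' $ k) (at t)"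
    by (rule bounded_linear.has_vector_derivative[OF bounded_linear_vec_nth])
  then show ?thesis
    by (simp add: D has_real_derivative_iff_has_vector_derivative)
qed

section \<open>Swirl\<close>

text \<open>
  This is \<open>\<partial>\<^sub>\<theta> v\<^sup>\<theta> = 0\<close> multiplied by \<open>r\<close> and written in Cartesian coordinates; in this form it is
  meaningful, and trivially true, on the axis.
\<close>

definition swirl_invariant :: "(real^3 \<Rightarrow> real^3) \<Rightarrow> bool" where
  "swirl_invariant v \<longleftrightarrow> (\<forall>x. (x $ 2)\<^sup>2 * partial 1 v x $ 1 + (x $ 1)\<^sup>2 * partial 2 v x $ 2
      - x $ 1 * x $ 2 * (partial 1 v x $ 2 + partial 2 v x $ 1) = x $ 1 * v x $ 1 + x $ 2 * v x $ 2)"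

text \<open>
  The derivative of \<open>- sin \<theta> v\<^sub>1 + cos \<theta> v\<^sub>2\<close> along the circle through \<open>x\<close> is computed by the chain
  rule; multiplied by \<open>r\<close> it is the defining equation.
\<close>

lemma swirl_invariantI:
  assumes v: "smooth v"
    and D: "\<And>r \<theta> z. r > 0 \<Longrightarrow>
      ((\<lambda>t. component e_theta v (cyl r t z)) has_real_derivative 0) (at \<theta>)"
  shows "swirl_invariant v"
  unfolding swirl_invariant_def
proof
  fix x :: "real^3"
  define r where "r = radius x"
  show "(x $ 2)\<^sup>2 * partial 1 v x $ 1 + (x $ 1)\<^sup>2 * partial 2 v x $ 2
      - x $ 1 * x $ 2 * (partial 1 v x $ 2 + partial 2 v x $ 1) = x $ 1 * v x $ 1 + x $ 2 * v x $ 2"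
  proof (cases "r = 0")
    case True
    then have "x $ 1 = 0" "x $ 2 = 0" by (auto simp: r_def radius_def)
    then show ?thesis by simp
  next
    case False
    then have r: "r > 0" by (simp add: r_def radius_def order_le_neq_trans)
    have r2: "r\<^sup>2 = (x $ 1)\<^sup>2 + (x $ 2)\<^sup>2" by (simp add: r_def radius_def)
    then have "(x $ 1 / r)\<^sup>2 + (x $ 2 / r)\<^sup>2 = r\<^sup>2 / r\<^sup>2"
      by (simp only: power_divide add_divide_distrib)
    then have "(x $ 1 / r)\<^sup>2 + (x $ 2 / r)\<^sup>2 = 1"
      using r by simp
    then obtain \<theta> where \<theta>: "x $ 1 / r = cos \<theta>" "x $ 2 / r = sin \<theta>"
      using sincos_total_2pi by metis
    then have x12: "x $ 1 = r * cos \<theta>" "x $ 2 = r * sin \<theta>" using r by (simp_all add: field_simps)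
    define c where "c = (\<lambda>t. cyl r t (x $ 3))"
    have cx: "c \<theta> = x" by (simp add: c_def cyl_def vec_eq_iff forall_3 x12)
    have ceq: "c = (\<lambda>t. (r * cos t) *\<^sub>R axis 1 1 + (r * sin t) *\<^sub>R axis 2 1 + (x $ 3) *\<^sub>R axis 3 1)"
      by (auto simp: c_def cyl_def vec_eq_iff forall_3 axis_def)
    define c' :: "real^3" where
      "c' = (- r * sin \<theta>) *\<^sub>R axis 1 1 + (r * cos \<theta>) *\<^sub>R axis 2 1"
    have c': "(c has_vector_derivative c') (at \<theta>)"
      unfolding ceq c'_def
      by (auto intro!: derivative_eq_intros simp: has_vector_derivative_def)
        (auto simp: algebra_simps)
    have c'n: "c' $ 1 = - r * sin \<theta>" "c' $ 2 = r * cos \<theta>" "c' $ 3 = 0"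
      by (auto simp: c'_def axis_def)
    have rad: "radius (c t) = r" for t
    proof -
      have "(r * cos t)\<^sup>2 + (r * sin t)\<^sup>2 = r\<^sup>2"
        by (simp add: power_mult_distrib flip: distrib_left)
      then show ?thesis using r by (simp add: c_def cyl_def radius_def)
    qed
    have comp: "component e_theta v (c t) = - sin t * v (c t) $ 1 + cos t * v (c t) $ 2" for t
      unfolding component_def e_theta_def rad inner_vec_def sum_3 using r
      by (simp add: c_def cyl_def)
    have "((\<lambda>t. - sin t * v (c t) $ 1 + cos t * v (c t) $ 2) has_real_derivative
        (- cos \<theta> * v x $ 1 - sin \<theta> * (\<Sum>i\<in>UNIV. c' $ i * partial i v (c \<theta>) $ 1)
         + (- sin \<theta> * v x $ 2 + cos \<theta> * (\<Sum>i\<in>UNIV. c' $ i * partial i v (c \<theta>) $ 2)))) (at \<theta>)"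
      by (rule derivative_eq_intros chain_rule_component[OF v c'] refl)+ (simp add: cx algebra_simps)
    moreover have "((\<lambda>t. - sin t * v (c t) $ 1 + cos t * v (c t) $ 2) has_real_derivative 0) (at \<theta>)"
      using D[OF r, of "x $ 3" \<theta>] comp by (simp add: c_def)
    ultimately have "- cos \<theta> * v x $ 1 - sin \<theta> * (\<Sum>i\<in>UNIV. c' $ i * partial i v x $ 1)
         + (- sin \<theta> * v x $ 2 + cos \<theta> * (\<Sum>i\<in>UNIV. c' $ i * partial i v x $ 2)) = 0"
      using DERIV_unique cx by fastforce
    then have "r * (- cos \<theta> * v x $ 1 - sin \<theta> * (\<Sum>i\<in>UNIV. c' $ i * partial i v x $ 1)
         + (- sin \<theta> * v x $ 2 + cos \<theta> * (\<Sum>i\<in>UNIV. c' $ i * partial i v x $ 2))) = 0"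
      by simp
    then show ?thesis
      by (simp add: sum_3 c'n x12 power2_eq_square algebra_simps)
  qed
qed

lemma swirl_invariant_of_axially_symmetric:
  "smooth v \<Longrightarrow> axially_symmetric v \<Longrightarrow> swirl_invariant v"
  by (rule swirl_invariantI) (auto simp: axially_symmetric_def)

lemma swirl_invariant_of_swirl_free:
  assumes "smooth v" "swirl_free v"
  shows "swirl_invariant v"
proof (rule swirl_invariantI[OF assms(1)])
  fix r \<theta> z :: real assume r: "r > 0"
  have "radius (cyl r t z) > 0" for t
  proof -
    have "(r * cos t)\<^sup>2 + (r * sin t)\<^sup>2 = r\<^sup>2"
      by (simp add: power_mult_distrib flip: distrib_left)
    then show ?thesis using r by (simp add: cyl_def radius_def)
  qed
  then have "component e_theta v (cyl r t z) = 0" for t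
    using assms(2) by (simp add: swirl_free_def)
  then show "((\<lambda>t. component e_theta v (cyl r t z)) has_real_derivative 0) (at \<theta>)"
    by simp
qed

section \<open>Vertical primitives\<close>

text \<open>
  The primitive \<open>\<integral>\<^bsub>-\<pi>\<^esub>\<^bsup>z\<^esup> f\<close> in the vertical variable, rescaled to the fixed interval \<open>[0, 1]\<close>: this
  gives the correct sign below \<open>z = -\<pi>\<close> and makes the dependence on \<open>x\<close> a parameter of the integrand.
\<close>

definition primitive_z :: "(real^3 \<Rightarrow> real) \<Rightarrow> real^3 \<Rightarrow> real" where
  "primitive_z f x = integral {0..1} (\<lambda>t. (x $ 3 + pi) * f (x + ((t - 1) * (x $ 3 + pi)) *\<^sub>R axis 3 1))"

lemma primitive_z_bottom: "x $ 3 = - pi \<Longrightarrow> primitive_z f x = 0"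
  by (simp add: primitive_z_def)

lemma continuous_integrand_primitive_z:
  assumes "continuous_on UNIV f"
  shows "continuous_on (UNIV \<times> A)
     (\<lambda>(x, t). (x $ 3 + pi) * f (x + ((t - 1) * (x $ 3 + pi)) *\<^sub>R axis 3 1))"
  unfolding split_beta
  by (intro continuous_on_mult continuous_on_compose2[OF assms _ subset_UNIV])
    (intro continuous_intros)+

lemma continuous_primitive_z:
  assumes "continuous_on UNIV f"
  shows "continuous_on UNIV (primitive_z f)"
proof -
  have "primitive_z f = (\<lambda>x. integral (cbox 0 1)
      (\<lambda>t. (x $ 3 + pi) * f (x + ((t - 1) * (x $ 3 + pi)) *\<^sub>R axis 3 1)))"
    by (simp add: primitive_z_def fun_eq_iff)
  with integral_continuous_on_param[OF continuous_integrand_primitive_z[OF assms]]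
  show ?thesis by simp
qed

lemma has_partial_primitive_z_horizontal:
  assumes i: "i \<noteq> 3" and D: "has_partial i f g" and f: "continuous_on UNIV f"
    and g: "continuous_on UNIV g"
  shows "has_partial i (primitive_z f) (primitive_z g)"
  unfolding has_partial_def
proof
  fix x
  let ?k = "\<lambda>h s t. (x $ 3 + pi) *
       h (x + ((t - 1) * (x $ 3 + pi)) *\<^sub>R axis 3 (1::real) + s *\<^sub>R axis i 1)"
  have eq: "primitive_z h (x + s *\<^sub>R axis i 1) = integral (cbox 0 1) (?k h s)" for h s
    using i by (simp add: primitive_z_def axis_def algebra_simps)
  have c: "continuous_on (X \<times> Y) (\<lambda>(s, t). ?k h s t)" if h: "continuous_on UNIV h" for h X Y
    unfolding split_beta
    by (intro continuous_on_mult continuous_on_compose2[OF h _ subset_UNIV])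
      (intro continuous_intros)+
  have "((\<lambda>s. integral (cbox 0 1) (?k f s)) has_field_derivative
      integral (cbox 0 1) (?k g 0)) (at 0 within UNIV)"
  proof (rule leibniz_rule_field_derivative[where fx = "?k g"])
    show "((\<lambda>s. ?k f s t) has_field_derivative ?k g s t) (at s within UNIV)" for s t
      by (intro DERIV_cmult has_partial_along_line D)
    show "?k f s integrable_on cbox 0 1" for s
    proof (rule integrable_continuous)
      show "continuous_on (cbox 0 1) (?k f s)"
        by (intro continuous_on_mult continuous_on_compose2[OF f _ subset_UNIV])
          (intro continuous_intros)+
    qed
  qed (auto intro: c[OF g])
  then show "((\<lambda>t. primitive_z f (x + t *\<^sub>R axis i 1)) has_real_derivative primitive_z g x) (at 0)"
    using eq[of g 0] by (simp add: eq)
qed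

text \<open>
  Undo the rescaling: along the vertical line through \<open>x\<close> the integrand is the derivative of an
  antiderivative \<open>\<Phi>\<close> composed with an affine map. The interval \<open>[-N, N]\<close> on which \<open>\<Phi>\<close> is
  taken contains both \<open>-\<pi>\<close> and the third coordinate of \<open>x\<close> in its interior.
\<close>

lemma has_partial_primitive_z_vertical:
  assumes f: "continuous_on UNIV f"
  shows "has_partial 3 (primitive_z f) f"
  unfolding has_partial_def
proof
  fix x :: "real^3"
  define N where "N = \<bar>x $ 3\<bar> + 5"
  let ?l = "\<lambda>z. x + (z - x $ 3) *\<^sub>R axis 3 1"
  have cl: "continuous_on A (\<lambda>z. f (?l z))" for A
    by (intro continuous_on_compose2[OF f _ subset_UNIV] continuous_intros)
  obtain \<Phi> where \<Phi>: "\<And>z. z \<in> {-N..N} \<Longrightarrow> (\<Phi> has_vector_derivative f (?l z)) (at z within {-N..N})"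
    using antiderivative_continuous[OF cl[of "{-N..N}"]] by blast
  have N: "pi < N" "- pi \<le> N" unfolding N_def using pi_less_4 pi_gt_zero by linarith+
  have prim: "primitive_z f (?l z) = \<Phi> z - \<Phi> (- pi)" if z: "z \<in> {-N<..<N}" for z
  proof -
    let ?a = "\<lambda>t. - pi + t * (z + pi)"
    have a: "?a t \<in> {-N..N}" if "t \<in> {0..1}" for t
    proof -
      have "?a t = (1 - t) *\<^sub>R (- pi) + t *\<^sub>R z" by (simp add: algebra_simps)
      moreover have "\<dots> \<in> {-N..N}"
        using that z N by (intro convexD_alt) (auto simp: algebra_simps)
      ultimately show ?thesis by metis
    qed
    have "((\<lambda>t. (z + pi) * f (?l (?a t))) has_integral \<Phi> (?a 1) - \<Phi> (?a 0)) {0..1}"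
    proof (rule fundamental_theorem_of_calculus)
      fix t :: real assume t: "t \<in> {0..1}"
      have "((\<Phi> \<circ> ?a) has_vector_derivative (z + pi) *\<^sub>R f (?l (?a t))) (at t within {0..1})"
      proof (rule vector_diff_chain_within)
        show "(?a has_vector_derivative z + pi) (at t within {0..1})"
          by (auto intro!: derivative_eq_intros)
        show "(\<Phi> has_vector_derivative f (?l (?a t))) (at (?a t) within ?a ` {0..1})"
        proof (rule has_vector_derivative_within_subset[OF \<Phi>[OF a[OF t]]])
          show "?a ` {0..1} \<subseteq> {-N..N}" by (intro image_subsetI a)
        qed
      qed
      then show "((\<lambda>t. \<Phi> (?a t)) has_vector_derivative (z + pi) * f (?l (?a t))) (at t within {0..1})"
        by (simp add: o_def)
    qed simp
    moreover have "(?l z) $ 3 = z" by (simp add: axis_def)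
    moreover have "?l z + ((t - 1) * (z + pi)) *\<^sub>R axis 3 1 = ?l (?a t)" for t
      by (simp add: algebra_simps)
    ultimately show ?thesis
      unfolding primitive_z_def by (simp only: integral_unique) simp
  qed
  have "x $ 3 \<in> {-N<..<N}" by (auto simp: N_def)
  then have "(\<Phi> has_vector_derivative f (?l (x $ 3))) (at (x $ 3))"
    using \<Phi>[of "x $ 3"] at_within_interior[of "x $ 3" "{-N..N}"] by simp
  then have "((\<lambda>z. \<Phi> z - \<Phi> (- pi)) has_real_derivative f x) (at (x $ 3))"
    by (auto intro!: derivative_eq_intros simp: has_real_derivative_iff_has_vector_derivative[symmetric])
  then have F: "((\<lambda>z. \<Phi> z - \<Phi> (- pi)) has_real_derivative f x) (at (x $ 3))"
    by simp
  have "\<forall>\<^sub>F z in nhds (x $ 3). z \<in> {-N<..<N}"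
    using \<open>x $ 3 \<in> {-N<..<N}\<close> by (intro eventually_nhds_in_open) auto
  then have "\<forall>\<^sub>F z in nhds (x $ 3). primitive_z f (?l z) = \<Phi> z - \<Phi> (- pi)"
    by eventually_elim (rule prim)
  then have "((\<lambda>z. primitive_z f (?l z)) has_real_derivative f x) (at (x $ 3))"
    by (rule DERIV_cong_ev[OF refl _ refl, THEN iffD2, OF _ F])
  then show "((\<lambda>t. primitive_z f (x + t *\<^sub>R axis 3 1)) has_real_derivative f x) (at 0)"
    using DERIV_shift[of "\<lambda>z. primitive_z f (?l z)" "f x" 0 "x $ 3"] by simp
qed

section \<open>The radial flux\<close>

text \<open>
  The moment \<open>x' \<cdot> v' = r v\<^sup>r\<close>, which unlike \<open>v\<^sup>r\<close> is smooth across the axis.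
\<close>

definition radial :: "(real^3 \<Rightarrow> real^3) \<Rightarrow> real^3 \<Rightarrow> real" where
  "radial v x = x $ 1 * v x $ 1 + x $ 2 * v x $ 2"

definition radial_partial :: "3 \<Rightarrow> (real^3 \<Rightarrow> real^3) \<Rightarrow> real^3 \<Rightarrow> real" where
  "radial_partial i v x =
     ((if 1 = i then 1 else 0) * v x $ 1 + x $ 1 * partial i v x $ 1) +
     ((if 2 = i then 1 else 0) * v x $ 2 + x $ 2 * partial i v x $ 2)"

lemma has_partial_radial: "smooth v \<Longrightarrow> has_partial i (radial v) (radial_partial i v)"
  unfolding radial_def radial_partial_def
  by (intro has_partial_add has_partial_mult has_partial_coord has_partial_component)

lemma continuous_radial: "smooth v \<Longrightarrow> continuous_on UNIV (radial v)"
  unfolding radial_def by (intro continuous_intros smooth_continuous)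

lemma continuous_radial_partial: "smooth v \<Longrightarrow> continuous_on UNIV (radial_partial i v)"
  unfolding radial_partial_def by (intro continuous_intros smooth_continuous smooth_partial)

text \<open>
  The vertical integral \<open>m t\<close> of the radial moment above the point \<open>t x'\<close> does not depend on \<open>t\<close>:
  by \<open>swirl_invariant\<close> and incompressibility its integrand has \<open>t\<close>-derivative
  \<open>- t \<bar>x'\<bar>\<^sup>2 \<partial>\<^sub>3 v\<^sub>3\<close>, whose integral over a period is zero. At \<open>t = 0\<close> the moment itself is zero.
\<close>

lemma primitive_radial_top:
  assumes v: "smooth v" and div: "\<And>x. divergence v x = 0" and sw: "swirl_invariant v"
    and per: "periodic_z v" and top: "x $ 3 = pi"
  shows "primitive_z (radial v) x = 0"
proof -
  define a b where "a = x $ 1" and "b = x $ 2"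
  define c :: "real \<Rightarrow> real \<Rightarrow> real^3" where "c t s = (t * a) *\<^sub>R axis 1 1 + (t * b) *\<^sub>R axis 2 1 +
      (- pi + 2 * pi * s) *\<^sub>R axis 3 (1::real)" for t s :: real
  have c: "c t s $ 1 = t * a" "c t s $ 2 = t * b" "c t s $ 3 = - pi + 2 * pi * s" for t s
    by (simp_all add: c_def axis_def)
  have c1: "c 1 s = x + ((s - 1) * (x $ 3 + pi)) *\<^sub>R axis 3 1" for s
    by (simp add: vec_eq_iff forall_3 c) (simp add: axis_def a_def b_def top algebra_simps)
  define g where "g t s = 2 * pi * radial v (c t s)" for t s
  define dg where "dg t s = 2 * pi * (a * v (c t s) $ 1 +
      t * a * (a * partial 1 v (c t s) $ 1 + b * partial 2 v (c t s) $ 1) + b * v (c t s) $ 2 +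
      t * b * (a * partial 1 v (c t s) $ 2 + b * partial 2 v (c t s) $ 2))" for t s
  have Dg: "((\<lambda>t. g t s) has_real_derivative dg t s) (at t)" for t s
  proof -
    let ?c' = "a *\<^sub>R axis 1 1 + b *\<^sub>R axis 2 (1::real) :: real^3"
    have c': "((\<lambda>t. c t s) has_vector_derivative ?c') (at t)"
      unfolding c_def by (auto intro!: derivative_eq_intros simp: has_vector_derivative_def)
        (auto simp: algebra_simps)
    show ?thesis unfolding g_def dg_def radial_def c
      by (rule derivative_eq_intros chain_rule_component[OF v c'] refl)+
        (simp add: sum_3 axis_def algebra_simps)
  qed
  have cont: "continuous_on A (\<lambda>z. f (c (fst z) (snd z)))"
    if "continuous_on UNIV f" for f :: "real^3 \<Rightarrow> real" and A
    unfolding c_def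
    by (rule continuous_on_compose2[OF that _ subset_UNIV]) (intro continuous_intros)
  have "continuous_on {0..1} (\<lambda>s. radial v (c t s))" for t
    unfolding c_def
    by (rule continuous_on_compose2[OF continuous_radial[OF v] _ subset_UNIV])
      (intro continuous_intros)
  then have cg: "continuous_on {0..1} (g t)" for t
    unfolding g_def[abs_def] by (intro continuous_on_mult_left)
  have cdg: "continuous_on A (\<lambda>(t, s). dg t s)" for A
    unfolding dg_def split_beta
    by (intro continuous_on_add continuous_on_mult continuous_on_const continuous_on_fst
        continuous_on_id cont[OF continuous_component] v smooth_partial)
  define m where "m t = integral {0..1} (g t)" for t
  have Dm: "(m has_real_derivative integral {0..1} (dg t)) (at t)" for t
  proof -
    have "((\<lambda>t. integral (cbox 0 1) (g t)) has_field_derivative integral (cbox 0 1) (dg t))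
        (at t within UNIV)"
      by (rule leibniz_rule_field_derivative)
        (use Dg cdg cg in \<open>auto intro!: integrable_continuous_real\<close>)
    then show ?thesis by (simp add: m_def[abs_def])
  qed
  \<comment> \<open>\<open>swirl_invariant\<close> determines \<open>t * dg\<close> only, so \<open>t = 0\<close> is left to continuity of \<open>m\<close>\<close>
  have zero: "integral {0..1} (dg t) = 0" if t: "t > 0" for t
  proof -
    let ?F = "\<lambda>s. - t * (a\<^sup>2 + b\<^sup>2) * v (c t s) $ 3"
    have eq: "dg t s = - t * (a\<^sup>2 + b\<^sup>2) * (2 * pi * partial 3 v (c t s) $ 3)" for s
    proof -
      let ?d = "\<lambda>i k. partial i v (c t s) $ k"
      have S: "(t * b)\<^sup>2 * ?d 1 1 + (t * a)\<^sup>2 * ?d 2 2 - t * a * (t * b) * (?d 1 2 + ?d 2 1)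
          = t * a * v (c t s) $ 1 + t * b * v (c t s) $ 2"
        using sw[unfolded swirl_invariant_def, rule_format, of "c t s"] by (simp add: c)
      have d3: "?d 3 3 = - ?d 1 1 - ?d 2 2"
        using div[of "c t s"] divergence_components[OF v, of "c t s"] by simp
      have "t * (a * v (c t s) $ 1 +
          t * a * (a * ?d 1 1 + b * ?d 2 1) + b * v (c t s) $ 2 +
          t * b * (a * ?d 1 2 + b * ?d 2 2)) = t * (t * (a\<^sup>2 + b\<^sup>2) * (?d 1 1 + ?d 2 2))"
        using S by (simp add: power2_eq_square algebra_simps)
      then have "a * v (c t s) $ 1 +
          t * a * (a * ?d 1 1 + b * ?d 2 1) + b * v (c t s) $ 2 +
          t * b * (a * ?d 1 2 + b * ?d 2 2) = t * (a\<^sup>2 + b\<^sup>2) * (?d 1 1 + ?d 2 2)"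
        using t by (simp only: mult_cancel_left) simp
      then show ?thesis by (simp only: dg_def d3) (simp add: algebra_simps)
    qed
    have "(dg t has_integral ?F 1 - ?F 0) {0..1}"
    proof (rule fundamental_theorem_of_calculus)
      fix s :: real
      have c': "((\<lambda>s. c t s) has_vector_derivative (2 * pi) *\<^sub>R axis 3 1) (at s)"
        unfolding c_def by (auto intro!: derivative_eq_intros simp: has_vector_derivative_def)
      have "(?F has_real_derivative dg t s) (at s)"
        unfolding eq
        by (rule derivative_eq_intros chain_rule_component[OF v c'] refl)+
          (simp add: sum_3 axis_def)
      then show "(?F has_vector_derivative dg t s) (at s within {0..1})"
        by (simp add: has_real_derivative_iff_has_vector_derivative has_vector_derivative_at_within)
    qed simp
    moreover have "c t 1 = c t 0 + axis 3 (2 * pi)"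
      by (simp add: vec_eq_iff forall_3 c) (simp add: axis_def)
    then have "v (c t 1) = v (c t 0)" using per by (simp add: periodic_z_def)
    ultimately show ?thesis by (simp add: integral_unique)
  qed
  have "m 1 = m 0"
  proof (rule DERIV_isconst2[of 0 1])
    show "continuous_on {0..1} m"
      using Dm by (meson DERIV_continuous continuous_at_imp_continuous_on)
    show "DERIV m t :> 0" if "0 < t" for t using Dm[of t] zero[OF that] by simp
  qed auto
  moreover have "g 0 = (\<lambda>s. 0)" by (simp add: fun_eq_iff g_def radial_def c)
  then have "m 0 = 0" by (simp add: m_def)
  moreover have "g 1 = (\<lambda>s. (x $ 3 + pi) * radial v (x + ((s - 1) * (x $ 3 + pi)) *\<^sub>R axis 3 1))"
    by (simp only: fun_eq_iff g_def c1) (simp add: top)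
  then have "m 1 = primitive_z (radial v) x" by (simp only: m_def primitive_z_def)
  ultimately show ?thesis by simp
qed

section \<open>Square integrals over slabs\<close>

definition slab :: "real \<Rightarrow> (real^3) set" where
  "slab R = cbox (vector [-R, -R, -pi]) (vector [R, R, pi])"

lemma mem_slab: "x \<in> slab R \<longleftrightarrow> \<bar>x $ 1\<bar> \<le> R \<and> \<bar>x $ 2\<bar> \<le> R \<and> \<bar>x $ 3\<bar> \<le> pi"
  by (auto simp: slab_def mem_box_cart forall_3)

lemma slab_subset_cell: "slab R \<subseteq> cell"
  by (auto simp: mem_slab cell_def)

lemma integrable_slab:
  fixes f :: "real^3 \<Rightarrow> real"
  shows "continuous_on UNIV f \<Longrightarrow> f integrable_on slab R"
  unfolding slab_def by (meson continuous_on_subset integrable_continuous subset_UNIV)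

lemma integral_slab_const:
  assumes "R \<ge> 0"
  shows "integral (slab R) (\<lambda>x. c :: real) = 8 * pi * R\<^sup>2 * c"
proof -
  have "(0::real^3) \<in> slab R" using assms by (simp add: mem_slab)
  then have "slab R \<noteq> {}" by blast
  then have "measure lborel (slab R) =
      (\<Prod>i\<in>UNIV. vector [R, R, pi] $ i - (vector [-R, -R, -pi] :: real^3) $ i)"
    unfolding slab_def by (rule content_cbox_cart)
  then have "measure lborel (slab R) = 8 * pi * R\<^sup>2"
    unfolding UNIV_3 by (simp add: power2_eq_square)
  then show ?thesis by (simp add: slab_def)
qed

lemma integral_slab_mono:
  fixes f g :: "real^3 \<Rightarrow> real"
  assumes "continuous_on UNIV f" "continuous_on UNIV g" "\<And>x. x \<in> slab R \<Longrightarrow> f x \<le> g x"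
  shows "integral (slab R) f \<le> integral (slab R) g"
  by (intro integral_le integrable_slab assms)

definition grad_sq :: "(real^3 \<Rightarrow> real^3) \<Rightarrow> real^3 \<Rightarrow> real" where
  "grad_sq v x = (\<Sum>i\<in>UNIV. (norm (partial i v x))\<^sup>2)"

lemma continuous_grad_sq: "smooth v \<Longrightarrow> continuous_on UNIV (grad_sq v)"
  unfolding grad_sq_def by (intro continuous_intros smooth_continuous smooth_partial)

lemma norm_sq_components: "(norm (y :: real^3))\<^sup>2 = (\<Sum>k\<in>UNIV. (y $ k)\<^sup>2)"
  by (simp add: norm_vec_def L2_set_def sum_nonneg)

lemma grad_sq_components: "grad_sq v x = (\<Sum>i\<in>UNIV. \<Sum>k\<in>UNIV. (partial i v x $ k)\<^sup>2)"
  by (simp add: grad_sq_def norm_sq_components)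

lemma grad_sq_nonneg: "0 \<le> grad_sq v x"
  by (simp add: grad_sq_def sum_nonneg)

lemma norm_partial_sq_le: "(norm (partial i v x))\<^sup>2 \<le> grad_sq v x"
  unfolding grad_sq_def by (rule member_le_sum) auto

lemma cauchy_schwarz_2: "((a::real) * b + c * d)\<^sup>2 \<le> (a\<^sup>2 + c\<^sup>2) * (b\<^sup>2 + d\<^sup>2)"
proof -
  have "(a\<^sup>2 + c\<^sup>2) * (b\<^sup>2 + d\<^sup>2) - (a * b + c * d)\<^sup>2 = (a * d - b * c)\<^sup>2"
    by (simp add: power2_eq_square algebra_simps)
  then show ?thesis using zero_le_power2[of "a * d - b * c"] by linarith
qed

lemma horizontal_combination_le:
  assumes "x \<in> slab R"
  shows "(x $ 1 * y $ 1 + x $ 2 * y $ 2)\<^sup>2 \<le> 2 * R\<^sup>2 * (norm (y :: real^3))\<^sup>2"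
proof -
  have "(x $ 1)\<^sup>2 \<le> R\<^sup>2" "(x $ 2)\<^sup>2 \<le> R\<^sup>2"
    using assms by (auto simp: mem_slab intro: abs_le_square_iff[THEN iffD1])
  moreover have "(y $ 1)\<^sup>2 + (y $ 2)\<^sup>2 \<le> (norm y)\<^sup>2"
    by (simp add: norm_sq_components sum_3)
  ultimately have "((x $ 1)\<^sup>2 + (x $ 2)\<^sup>2) * ((y $ 1)\<^sup>2 + (y $ 2)\<^sup>2) \<le> (2 * R\<^sup>2) * (norm y)\<^sup>2"
    by (intro mult_mono) auto
  then show ?thesis using cauchy_schwarz_2 order_trans by blast
qed

text \<open>
  What the estimates use of each of the two fields: \<open>M\<close> bounds the square of its size, and \<open>E\<close> its
  Dirichlet integral.
\<close>

locale swirl_invariant_field =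
  fixes v :: "real^3 \<Rightarrow> real^3" and M E :: real
  assumes smooth: "smooth v"
    and solenoidal: "\<And>x. divergence v x = 0"
    and swirl: "swirl_invariant v"
    and periodic: "periodic_z v"
    and bounded: "\<And>x. x \<in> cell \<Longrightarrow> (norm (v x))\<^sup>2 \<le> M"
    and dirichlet: "\<And>R. R \<ge> 1 \<Longrightarrow> integral (slab R) (grad_sq v) \<le> E"
begin

text \<open>
  In the axially symmetric case this is, up to a function of \<open>r\<close> and the sign convention,
  the Stokes stream function of \<open>v\<close>.
\<close>

definition stream :: "real^3 \<Rightarrow> real" where
  "stream = primitive_z (radial v)"

definition stream_partial :: "3 \<Rightarrow> real^3 \<Rightarrow> real" where
  "stream_partial i = (if i = 3 then radial v else primitive_z (radial_partial i v))"

lemma continuous_stream: "continuous_on UNIV stream"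
  unfolding stream_def by (intro continuous_primitive_z continuous_radial smooth)

lemma continuous_stream_partial: "continuous_on UNIV (stream_partial i)"
  unfolding stream_partial_def
  by (simp add: continuous_primitive_z continuous_radial continuous_radial_partial smooth)

lemma has_partial_stream: "has_partial i stream (stream_partial i)"
  unfolding stream_def stream_partial_def
  by (simp add: has_partial_primitive_z_vertical has_partial_primitive_z_horizontal
      has_partial_radial continuous_radial continuous_radial_partial smooth)

lemma stream_bottom: "x $ 3 = - pi \<Longrightarrow> stream x = 0"
  by (simp add: stream_def primitive_z_bottom)

lemma stream_top: "x $ 3 = pi \<Longrightarrow> stream x = 0"
  by (simp add: stream_def primitive_radial_top smooth solenoidal swirl periodic)

text \<open>
  The stream function is zero at both ends of the vertical segment, so Rolle's theorem applies.
  This replaces subtracting the mean in the Poincare inequality.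
\<close>

lemma radial_vanishes_somewhere: "\<exists>s\<in>{- pi..pi}. radial v (x + (s - x $ 3) *\<^sub>R axis 3 1) = 0"
proof -
  let ?l = "\<lambda>s. x + (s - x $ 3) *\<^sub>R axis 3 (1::real)"
  have D: "((\<lambda>s. stream (?l s)) has_real_derivative radial v (?l s)) (at s)" for s
    using DERIV_shift[of "\<lambda>s. stream (x + s *\<^sub>R axis 3 1)" "radial v (?l s)" s "- x $ 3"]
      has_partial_along_line[OF has_partial_stream[of 3], of x "s - x $ 3"]
    by (simp add: stream_partial_def)
  have "stream (?l (- pi)) = stream (?l pi)"
    by (simp add: stream_bottom stream_top axis_def)
  moreover have "continuous_on {- pi..pi} (\<lambda>s. stream (?l s))"
    by (intro continuous_on_compose2[OF continuous_stream _ subset_UNIV] continuous_intros)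
  moreover have "(\<lambda>s. stream (?l s)) differentiable at s" for s
    using D real_differentiable_def by blast
  ultimately obtain z where "- pi < z" "z < pi" "DERIV (\<lambda>s. stream (?l s)) z :> 0"
    using Rolle[of "- pi" pi "\<lambda>s. stream (?l s)"] by auto
  then show ?thesis using DERIV_unique[OF D] by (intro bexI[of _ z]) auto
qed

lemma poincare_slab:
  assumes "has_partial 3 f g" "continuous_on UNIV f" "continuous_on UNIV g"
    and "\<And>x. \<exists>s\<in>{- pi..pi}. f (x + (s - x $ 3) *\<^sub>R axis 3 1) = 0"
  shows "integral (slab R) (\<lambda>x. (f x)\<^sup>2) \<le> 4 * pi\<^sup>2 * integral (slab R) (\<lambda>x. (g x)\<^sup>2)"
  using poincare_slices[OF assms(1-3), of "vector [-R, -R, -pi]" "vector [R, R, pi]"] assms(4)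
  by (simp add: slab_def power_mult_distrib)

lemma integral_grad_le:
  assumes "R \<ge> 1" "c \<ge> 0" shows "integral (slab R) (\<lambda>x. c * grad_sq v x) \<le> c * E"
  using mult_left_mono[OF dirichlet[OF assms(1)] assms(2)] by simp

text \<open>
  Only \<open>\<partial>\<^sub>3 (x' \<cdot> v') = x' \<cdot> \<partial>\<^sub>3 v'\<close> enters, at the cost of the factor \<open>\<bar>x'\<bar>\<^sup>2 \<le> 2 R\<^sup>2\<close>.
\<close>

lemma radial_L2:
  assumes R: "R \<ge> 1"
  shows "integral (slab R) (\<lambda>x. (radial v x)\<^sup>2) \<le> 8 * pi\<^sup>2 * E * R\<^sup>2"
proof -
  have "integral (slab R) (\<lambda>x. (radial v x)\<^sup>2) \<le>
      4 * pi\<^sup>2 * integral (slab R) (\<lambda>x. (radial_partial 3 v x)\<^sup>2)"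
    by (intro poincare_slab has_partial_radial continuous_radial continuous_radial_partial
        smooth radial_vanishes_somewhere)
  also have "integral (slab R) (\<lambda>x. (radial_partial 3 v x)\<^sup>2) \<le>
      integral (slab R) (\<lambda>x. 2 * R\<^sup>2 * grad_sq v x)"
  proof (rule integral_slab_mono)
    fix x assume "x \<in> slab R"
    from horizontal_combination_le[OF this, of "partial 3 v x"]
    have "(radial_partial 3 v x)\<^sup>2 \<le> 2 * R\<^sup>2 * (norm (partial 3 v x))\<^sup>2"
      by (simp add: radial_partial_def)
    also have "\<dots> \<le> 2 * R\<^sup>2 * grad_sq v x"
      by (intro mult_left_mono norm_partial_sq_le) auto
    finally show "(radial_partial 3 v x)\<^sup>2 \<le> 2 * R\<^sup>2 * grad_sq v x" .
  qed (intro continuous_intros continuous_radial_partial continuous_grad_sq smooth)+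
  also have "\<dots> \<le> 2 * R\<^sup>2 * E" by (rule integral_grad_le[OF R]) simp
  finally show ?thesis by (simp add: mult_left_mono algebra_simps)
qed

lemma stream_L2:
  assumes R: "R \<ge> 1"
  shows "integral (slab R) (\<lambda>x. (stream x)\<^sup>2) \<le> 32 * pi ^ 4 * E * R\<^sup>2"
proof -
  have "\<exists>s\<in>{- pi..pi}. stream (x + (s - x $ 3) *\<^sub>R axis 3 1) = 0" for x
    by (rule bexI[of _ "- pi"]) (auto simp: stream_bottom axis_def)
  then have "integral (slab R) (\<lambda>x. (stream x)\<^sup>2) \<le>
      4 * pi\<^sup>2 * integral (slab R) (\<lambda>x. (radial v x)\<^sup>2)"
    using has_partial_stream[of 3] continuous_radial[OF smooth]
    by (intro poincare_slab continuous_stream) (auto simp: stream_partial_def)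
  also have "\<dots> \<le> 4 * pi\<^sup>2 * (8 * pi\<^sup>2 * E * R\<^sup>2)"
    by (intro mult_left_mono radial_L2[OF R]) auto
  finally show ?thesis by (simp add: eval_nat_numeral algebra_simps)
qed

text \<open>
  A horizontal derivative of the moment contributes a term \<open>v\<^sub>i\<close> besides \<open>x' \<cdot> \<partial>\<^sub>i v'\<close>; as \<open>v\<close> is bounded,
  its square integral is at most a multiple of the volume of the slab, hence also of order \<open>R\<^sup>2\<close>.
\<close>

lemma stream_partial_L2:
  assumes R: "R \<ge> 1"
  shows "integral (slab R) (\<lambda>x. (stream_partial i x)\<^sup>2) \<le> (64 * pi ^ 3 * M + 16 * pi\<^sup>2 * E) * R\<^sup>2"
proof (cases "i = 3")
  case True
  have "0 \<le> integral (slab 1) (grad_sq v)"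
    by (intro integral_nonneg integrable_slab continuous_grad_sq smooth) (simp add: grad_sq_nonneg)
  then have "0 \<le> E" using dirichlet[of 1] by simp
  moreover have "0 \<le> M" using bounded[of 0] by (simp add: cell_def order_trans[OF zero_le_power2])
  ultimately have "8 * pi\<^sup>2 * E * R\<^sup>2 \<le> (64 * pi ^ 3 * M + 16 * pi\<^sup>2 * E) * R\<^sup>2"
    by (intro mult_right_mono) auto
  then show ?thesis using radial_L2[OF R] True by (simp add: stream_partial_def)
next
  case False
  have "\<exists>s\<in>{- pi..pi}. stream_partial i (x + (s - x $ 3) *\<^sub>R axis 3 1) = 0" for x
    using False by (intro bexI[of _ "- pi"]) (auto simp: stream_partial_def primitive_z_bottom axis_def)
  then have "integral (slab R) (\<lambda>x. (stream_partial i x)\<^sup>2) \<le>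
      4 * pi\<^sup>2 * integral (slab R) (\<lambda>x. (radial_partial i v x)\<^sup>2)"
    using False has_partial_primitive_z_vertical[OF continuous_radial_partial[OF smooth]]
    by (intro poincare_slab continuous_stream_partial continuous_radial_partial smooth)
      (auto simp: stream_partial_def)
  also have "integral (slab R) (\<lambda>x. (radial_partial i v x)\<^sup>2) \<le>
      integral (slab R) (\<lambda>x. 2 * M + 4 * R\<^sup>2 * grad_sq v x)"
  proof (rule integral_slab_mono)
    fix x assume x: "x \<in> slab R"
    define A where "A = (if 1 = i then 1 else 0) * v x $ 1 + (if 2 = i then 1 else 0) * v x $ 2"
    define B where "B = x $ 1 * partial i v x $ 1 + x $ 2 * partial i v x $ 2"
    have "A\<^sup>2 \<le> (norm (v x))\<^sup>2"
      by (auto simp: A_def norm_sq_components sum_3)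
    then have "A\<^sup>2 \<le> M" using bounded[of x] x slab_subset_cell[of R] by fastforce
    moreover have "B\<^sup>2 \<le> 2 * R\<^sup>2 * grad_sq v x"
      using horizontal_combination_le[OF x, of "partial i v x"]
        mult_left_mono[OF norm_partial_sq_le[of i v x], of "2 * R\<^sup>2"]
      by (simp add: B_def)
    moreover have "(A + B)\<^sup>2 \<le> 2 * A\<^sup>2 + 2 * B\<^sup>2"
      using zero_le_power2[of "A - B"] by (simp add: power2_eq_square algebra_simps)
    moreover have "radial_partial i v x = A + B"
      by (simp add: radial_partial_def A_def B_def)
    ultimately show "(radial_partial i v x)\<^sup>2 \<le> 2 * M + 4 * R\<^sup>2 * grad_sq v x" by simp
  qed (intro continuous_intros continuous_radial_partial continuous_grad_sq smooth)+
  also have "\<dots> = integral (slab R) (\<lambda>x. 2 * M) + integral (slab R) (\<lambda>x. 4 * R\<^sup>2 * grad_sq v x)"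
    by (intro integral_add integrable_slab continuous_intros continuous_grad_sq smooth)
  also have "\<dots> \<le> 8 * pi * R\<^sup>2 * (2 * M) + 4 * R\<^sup>2 * E"
    using R integral_grad_le[OF R, of "4 * R\<^sup>2"] by (simp only: integral_slab_const) auto
  finally show ?thesis by (simp add: mult_left_mono eval_nat_numeral algebra_simps)
qed

end

section \<open>Cut-off functions\<close>

text \<open>
  The exponent counts the available smoothness: differentiating lowers it by one, and the
  energy argument uses 3, 2 and 1 in turn.
\<close>

definition cutoff :: "nat \<Rightarrow> real \<Rightarrow> real^3 \<Rightarrow> real" where
  "cutoff n R x = (max 0 (1 - ((x $ 1)\<^sup>2 + (x $ 2)\<^sup>2) / R\<^sup>2)) ^ n"

definition horizontal :: "3 \<Rightarrow> real^3 \<Rightarrow> real" where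
  "horizontal i x = (if i = 3 then 0 else x $ i)"

text \<open>
  Exponent at least two makes the power of the positive part continuously differentiable at its
  corner.
\<close>

lemma DERIV_positive_part_power:
  "((\<lambda>s::real. (max 0 s) ^ Suc (Suc n)) has_real_derivative real (Suc (Suc n)) * (max 0 s) ^ Suc n) (at s)"
proof (cases "s = 0")
  case False
  define f where "f = (if s > 0 then (\<lambda>s::real. s ^ Suc (Suc n)) else (\<lambda>s. 0))"
  define S where "S = (if s > 0 then {0<..} else {..<0::real})"
  have S: "open S" "s \<in> S" using False by (auto simp: S_def)
  have eq: "max 0 t ^ Suc (Suc n) = f t" if "t \<in> S" for t
    using that by (auto simp: S_def f_def split: if_splits)
  have "(f has_real_derivative real (Suc (Suc n)) * (max 0 s) ^ Suc n) (at s)"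
    using False DERIV_pow[of "Suc (Suc n)" s] by (auto simp: f_def)
  then show ?thesis
    by (rule has_field_derivative_transform_within_open[OF _ S]) (rule eq[symmetric])
next
  case True
  have "(\<lambda>h::real. max 0 h ^ Suc n) \<midarrow>0\<rightarrow> max 0 0 ^ Suc n"
    by (intro tendsto_intros)
  then have lim: "(\<lambda>h::real. max 0 h ^ Suc n) \<midarrow>0\<rightarrow> 0" by simp
  have "(\<lambda>h::real. max 0 h ^ Suc (Suc n) / h) \<midarrow>0\<rightarrow> 0"
  proof (rule Lim_transform_eventually[OF lim])
    show "\<forall>\<^sub>F h in at 0. max 0 h ^ Suc n = max 0 h ^ Suc (Suc n) / (h::real)"
      unfolding eventually_at by (intro exI[of _ 1]) (auto simp: max_def)
  qed
  then show ?thesis using True by (simp add: DERIV_def)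
qed

lemma continuous_cutoff: "continuous_on UNIV (cutoff n R)"
  unfolding cutoff_def divide_inverse by (intro continuous_intros)

lemma has_partial_cutoff:
  "has_partial i (cutoff (Suc (Suc n)) R)
     (\<lambda>x. - (2 * real (Suc (Suc n)) / R\<^sup>2) * (horizontal i x * cutoff (Suc n) R x))"
proof -
  define q where "q x = 1 - (x $ 1 * x $ 1 + x $ 2 * x $ 2) * (1 / R\<^sup>2)" for x :: "real^3"
  have "has_partial i q (\<lambda>x. 0 - (((if 1 = i then 1 else 0) * x $ 1 + x $ 1 * (if 1 = i then 1 else 0)
      + ((if 2 = i then 1 else 0) * x $ 2 + x $ 2 * (if 2 = i then 1 else 0))) * (1 / R\<^sup>2) +
      (x $ 1 * x $ 1 + x $ 2 * x $ 2) * 0))"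
    unfolding q_def
    by (intro has_partial_diff has_partial_mult has_partial_add has_partial_const has_partial_coord)
  also have "(\<lambda>x::real^3. 0 - (((if 1 = i then 1 else 0) * x $ 1 + x $ 1 * (if 1 = i then 1 else 0)
      + ((if 2 = i then 1 else 0) * x $ 2 + x $ 2 * (if 2 = i then 1 else 0))) * (1 / R\<^sup>2) +
      (x $ 1 * x $ 1 + x $ 2 * x $ 2) * 0)) = (\<lambda>x. - (2 / R\<^sup>2) * horizontal i x)"
    using exhaust_3[of i] by (auto simp: horizontal_def fun_eq_iff)
  finally have "has_partial i q (\<lambda>x. - (2 / R\<^sup>2) * horizontal i x)" .
  from has_partial_compose[OF DERIV_positive_part_power[of n] this]
  have "has_partial i (\<lambda>x. max 0 (q x) ^ Suc (Suc n))
     (\<lambda>x. real (Suc (Suc n)) * max 0 (q x) ^ Suc n * (- (2 / R\<^sup>2) * horizontal i x))" .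
  moreover have "cutoff m R = (\<lambda>x. max 0 (q x) ^ m)" for m
    by (simp add: fun_eq_iff cutoff_def q_def power2_eq_square)
  ultimately show ?thesis by (simp del: power_Suc of_nat_Suc add: mult_ac)
qed

lemma cutoff_nonneg: "0 \<le> cutoff n R x"
  by (simp add: cutoff_def)

lemma cutoff_le_1: "cutoff n R x \<le> 1"
  unfolding cutoff_def by (intro power_le_one) auto

lemma cutoff_lateral:
  assumes "i \<noteq> 3" "\<bar>x $ i\<bar> = R" "n > 0" "R > 0"
  shows "cutoff n R x = 0"
proof -
  have "R\<^sup>2 = (x $ i)\<^sup>2" using assms(2) by (metis power2_abs)
  then have "R\<^sup>2 \<le> (x $ 1)\<^sup>2 + (x $ 2)\<^sup>2"
    using assms(1) exhaust_3[of i] by auto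
  then have "1 - ((x $ 1)\<^sup>2 + (x $ 2)\<^sup>2) / R\<^sup>2 \<le> 0" using assms(4) by (simp add: field_simps)
  then show ?thesis using assms(3) by (simp add: cutoff_def max_absorb1)
qed

lemma cutoff_vertical_shift: "cutoff n R (x + axis 3 t) = cutoff n R x"
  by (simp add: cutoff_def axis_def)

lemma cutoff_lower_bound:
  assumes "R \<ge> 1" "x \<in> slab (R / 2)"
  shows "(1 / 2) ^ n \<le> cutoff n R x"
proof -
  have "(x $ 1)\<^sup>2 \<le> (R / 2)\<^sup>2" "(x $ 2)\<^sup>2 \<le> (R / 2)\<^sup>2"
    using assms by (auto simp: mem_slab abs_le_square_iff[symmetric])
  then have "(x $ 1)\<^sup>2 + (x $ 2)\<^sup>2 \<le> R\<^sup>2 / 2" by (simp add: power_divide)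
  then have "((x $ 1)\<^sup>2 + (x $ 2)\<^sup>2) / R\<^sup>2 \<le> 1 / 2"
    using assms by (simp add: divide_le_eq)
  then have "1 / 2 \<le> max 0 (1 - ((x $ 1)\<^sup>2 + (x $ 2)\<^sup>2) / R\<^sup>2)"
    by (intro max.coboundedI2) linarith
  then show ?thesis unfolding cutoff_def by (rule power_mono) simp
qed

lemma integral_slab_partial_zero:
  assumes D: "has_partial i F g" and g: "continuous_on UNIV g" and R: "R \<ge> 0"
    and lateral: "\<And>x. i \<noteq> 3 \<Longrightarrow> \<bar>x $ i\<bar> = R \<Longrightarrow> F x = 0"
    and vertical: "\<And>x. i = 3 \<Longrightarrow> x $ 3 = - pi \<Longrightarrow> F (x + axis 3 (2 * pi)) = F x"
  shows "integral (slab R) g = 0"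
  unfolding slab_def
proof (rule integral_partial_zero[OF D g])
  let ?a = "vector [-R, -R, -pi] :: real^3" and ?b = "vector [R, R, pi] :: real^3"
  show "?a $ i \<le> ?b $ i" using exhaust_3[of i] R by auto
  fix x assume x: "x $ i = ?a $ i"
  show "F (x + (?b $ i - ?a $ i) *\<^sub>R axis i 1) = F x"
  proof (cases "i = 3")
    case True
    then have "(?b $ i - ?a $ i) *\<^sub>R axis i 1 = axis 3 (2 * pi)"
      by (simp add: axis_def vec_eq_iff)
    then show ?thesis using vertical True x by simp
  next
    case False
    then have "?a $ i = - R" "?b $ i = R" using exhaust_3[of i] by auto
    then have "F x = 0" "F (x + (?b $ i - ?a $ i) *\<^sub>R axis i 1) = 0"
      using x R False by (auto intro!: lateral simp: axis_def)
    then show ?thesis by simp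
  qed
qed

text \<open>
  Integration by parts against a cut-off. Its gradient is radial, so only the radial moment of \<open>f\<close>
  survives on the right; the top and the bottom cancel by the assumption on \<open>f 3\<close>.
\<close>

lemma integral_cutoff_divergence:
  assumes D: "\<And>i. has_partial i (f i) (f' i)"
    and f: "\<And>i. continuous_on UNIV (f i)" and f': "\<And>i. continuous_on UNIV (f' i)"
    and vertical: "\<And>x. x $ 3 = - pi \<Longrightarrow> f 3 (x + axis 3 (2 * pi)) = f 3 x"
    and R: "R > 0"
  shows "integral (slab R) (\<lambda>x. cutoff (Suc (Suc n)) R x * (\<Sum>i\<in>UNIV. f' i x)) =
    2 * real (Suc (Suc n)) / R\<^sup>2 *
      integral (slab R) (\<lambda>x. cutoff (Suc n) R x * (x $ 1 * f 1 x + x $ 2 * f 2 x))"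
proof -
  let ?c = "2 * real (Suc (Suc n)) / R\<^sup>2"
  let ?g = "\<lambda>i x. - ?c * (horizontal i x * cutoff (Suc n) R x) * f i x + cutoff (Suc (Suc n)) R x * f' i x"
  have horizontal: "continuous_on UNIV (horizontal i)" for i
    unfolding horizontal_def by (cases "i = 3") (auto intro!: continuous_intros)
  have cg: "continuous_on UNIV (?g i)" for i
    by (intro continuous_intros horizontal continuous_cutoff f f')
  have g0: "integral (slab R) (?g i) = 0" for i
  proof (rule integral_slab_partial_zero[OF _ cg less_imp_le[OF R]])
    show "has_partial i (\<lambda>x. cutoff (Suc (Suc n)) R x * f i x) (?g i)"
      by (intro has_partial_mult has_partial_cutoff D)
  qed (auto simp: cutoff_lateral cutoff_vertical_shift vertical R)
  have "0 = (\<Sum>i\<in>UNIV. integral (slab R) (?g i))" by (simp only: g0) simp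
  also have "\<dots> = integral (slab R) (\<lambda>x. \<Sum>i\<in>UNIV. ?g i x)"
    by (intro integral_sum[symmetric] integrable_slab cg) auto
  also have "(\<lambda>x. \<Sum>i\<in>UNIV. ?g i x) = (\<lambda>x. cutoff (Suc (Suc n)) R x * (\<Sum>i\<in>UNIV. f' i x) -
      ?c * (cutoff (Suc n) R x * (x $ 1 * f 1 x + x $ 2 * f 2 x)))"
    by (rule ext) (simp only: sum_3, simp add: horizontal_def distrib_left distrib_right mult_ac)
  also have "integral (slab R) \<dots> = integral (slab R) (\<lambda>x. cutoff (Suc (Suc n)) R x * (\<Sum>i\<in>UNIV. f' i x)) -
      integral (slab R) (\<lambda>x. ?c * (cutoff (Suc n) R x * (x $ 1 * f 1 x + x $ 2 * f 2 x)))"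
    by (intro integral_diff integrable_slab continuous_intros continuous_cutoff f f')
  finally show ?thesis by simp
qed

section \<open>The equations\<close>

lemma continuous_partial: "smooth v \<Longrightarrow> continuous_on UNIV (partial i v)"
  by (intro smooth_continuous smooth_partial)

lemma continuous_convection:
  "smooth w \<Longrightarrow> smooth v \<Longrightarrow> continuous_on UNIV (convection w v)"
  unfolding convection_def
  by (intro continuous_on_sum continuous_on_scaleR continuous_component continuous_partial)

lemma has_partial_inner:
  fixes v w :: "real^3 \<Rightarrow> real^3"
  assumes "smooth v" "smooth w"
  shows "has_partial i (\<lambda>x. v x \<bullet> w x) (\<lambda>x. partial i v x \<bullet> w x + v x \<bullet> partial i w x)"
proof -
  have "has_partial i (\<lambda>x. \<Sum>k\<in>UNIV. v x $ k * w x $ k)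
      (\<lambda>x. \<Sum>k\<in>UNIV. partial i v x $ k * w x $ k + v x $ k * partial i w x $ k)"
    by (intro has_partial_sum has_partial_mult has_partial_component assms)
  then show ?thesis by (simp add: inner_vec_def sum.distrib)
qed

lemma periodic_partial:
  fixes v :: "real^3 \<Rightarrow> real^3"
  assumes v: "smooth v" and per: "periodic_z v"
  shows "periodic_z (partial i v)"
  unfolding periodic_z_def
proof
  fix x
  have "((\<lambda>t. v (x + axis 3 (2 * pi) + t *\<^sub>R axis i 1)) has_vector_derivative
      partial i v (x + axis 3 (2 * pi))) (at 0)"
    by (rule has_partial_frechet[OF smooth_differentiable[OF v]])
  moreover have "v (x + axis 3 (2 * pi) + t *\<^sub>R axis i 1) = v (x + t *\<^sub>R axis i 1)" for t
    using per[unfolded periodic_z_def, rule_format, of "x + t *\<^sub>R axis i 1"] by (simp add: add_ac)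
  ultimately have "((\<lambda>t. v (x + t *\<^sub>R axis i 1)) has_vector_derivative
      partial i v (x + axis 3 (2 * pi))) (at 0)" by simp
  with has_partial_frechet[OF smooth_differentiable[OF v]]
  show "partial i v (x + axis 3 (2 * pi)) = partial i v x"
    using vector_derivative_unique_at by blast
qed

lemma periodic_convection:
  assumes "smooth v" "periodic_z w" "periodic_z v"
  shows "convection w v (x + axis 3 (2 * pi)) = convection w v x"
  using assms periodic_partial[OF assms(1,3)] by (simp add: convection_def periodic_z_def)

lemma periodic_laplacian:
  fixes v :: "real^3 \<Rightarrow> real^3"
  assumes "smooth v" "periodic_z v"
  shows "laplacian v (x + axis 3 (2 * pi)) = laplacian v x"
proof -
  have "periodic_z (partial i (partial i v))" for i
    by (intro periodic_partial smooth_partial assms)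
  then show ?thesis by (simp add: laplacian_def periodic_z_def)
qed

lemma norm_convection_sq_le:
  "(norm (convection w v x))\<^sup>2 \<le> 3 * (norm (w x))\<^sup>2 * grad_sq v x"
proof -
  define d where "d i = norm (partial i v x)" for i
  have "norm (convection w v x) \<le> (\<Sum>i\<in>UNIV. \<bar>w x $ i\<bar> * d i)"
    unfolding convection_def d_def by (intro norm_sum[THEN order_trans]) (simp add: sum_mono)
  also have "\<dots> \<le> (\<Sum>i\<in>UNIV. norm (w x) * d i)"
    by (intro sum_mono mult_right_mono component_le_norm_cart) (simp add: d_def)
  also have "\<dots> = norm (w x) * (\<Sum>i\<in>UNIV. d i)" by (simp add: sum_distrib_left)
  finally have "(norm (convection w v x))\<^sup>2 \<le> (norm (w x))\<^sup>2 * (\<Sum>i\<in>UNIV. d i)\<^sup>2"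
    by (metis norm_ge_zero power_mono power_mult_distrib)
  moreover have "(\<Sum>i\<in>UNIV. d i)\<^sup>2 \<le> 3 * grad_sq v x"
    using sum_squares_ge_zero[of "d 1 - d 2" "d 2 - d 3"] zero_le_power2[of "d 1 - d 3"]
    by (simp add: grad_sq_def sum_3 d_def[symmetric] power2_eq_square algebra_simps)
  then have "(norm (w x))\<^sup>2 * (\<Sum>i\<in>UNIV. d i)\<^sup>2 \<le> (norm (w x))\<^sup>2 * (3 * grad_sq v x)"
    by (intro mult_left_mono) auto
  ultimately show ?thesis by simp
qed

locale mhd_solution = U: swirl_invariant_field u M E + H: swirl_invariant_field h M E for u h M E +
  fixes p :: "real^3 \<Rightarrow> real"
  assumes smooth_p: "smooth p"
    and momentum: "\<And>x. convection u u x + gradient p x - convection h h x - laplacian u x = 0"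
    and induction: "\<And>x. convection u h x - convection h u x - laplacian h x = 0"
begin

definition energy :: "real^3 \<Rightarrow> real" where
  "energy x = grad_sq u x + grad_sq h x"

definition field_sq :: "real^3 \<Rightarrow> real" where
  "field_sq x = (norm (u x))\<^sup>2 + (norm (h x))\<^sup>2"

definition vertical_force :: "real^3 \<Rightarrow> real" where
  "vertical_force x = convection u u x $ 3 - convection h h x $ 3"

definition radial_diffusion :: "real^3 \<Rightarrow> real" where
  "radial_diffusion x = x $ 1 * partial 1 u x $ 3 + x $ 2 * partial 2 u x $ 3"

lemmas continuous_fields =
  U.smooth H.smooth continuous_component[OF U.smooth] continuous_component[OF H.smooth]
  continuous_partial[OF U.smooth] continuous_partial[OF H.smooth] continuous_partial[OF smooth_p]
  continuous_partial[OF smooth_partial[OF U.smooth]] continuous_partial[OF smooth_partial[OF H.smooth]]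
  smooth_continuous[OF U.smooth] smooth_continuous[OF H.smooth] smooth_continuous[OF smooth_p]
  continuous_grad_sq[OF U.smooth] continuous_grad_sq[OF H.smooth]

lemma continuous_energy: "continuous_on UNIV energy"
  unfolding energy_def by (intro continuous_intros continuous_fields)

lemma continuous_field_sq: "continuous_on UNIV field_sq"
  unfolding field_sq_def by (intro continuous_intros continuous_fields)

lemma continuous_vertical_force: "continuous_on UNIV vertical_force"
  unfolding vertical_force_def
  by (intro continuous_intros continuous_convection U.smooth H.smooth)

lemma continuous_radial_diffusion: "continuous_on UNIV radial_diffusion"
  unfolding radial_diffusion_def by (intro continuous_intros continuous_fields)

lemma M_nonneg: "0 \<le> M"
  using U.bounded[of 0] by (simp add: cell_def order_trans[OF zero_le_power2])

lemma E_nonneg: "0 \<le> E"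
proof -
  have "0 \<le> integral (slab 1) (grad_sq u)"
    by (intro integral_nonneg integrable_slab continuous_fields) (simp add: grad_sq_nonneg)
  then show ?thesis using U.dirichlet[of 1] by simp
qed

lemma energy_nonneg: "0 \<le> energy x"
  by (simp add: energy_def grad_sq_nonneg)

lemma field_sq_nonneg: "0 \<le> field_sq x"
  by (simp add: field_sq_def)

lemma field_sq_le: "x \<in> cell \<Longrightarrow> field_sq x \<le> 2 * M"
  using U.bounded[of x] H.bounded[of x] by (simp add: field_sq_def)

lemma integral_energy_le: "R \<ge> 1 \<Longrightarrow> integral (slab R) energy \<le> 2 * E"
  using U.dirichlet[of R] H.dirichlet[of R]
    integral_add[OF integrable_slab[OF continuous_grad_sq[OF U.smooth], of R]
      integrable_slab[OF continuous_grad_sq[OF H.smooth], of R]]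
  by (simp add: energy_def[abs_def])

lemma vertical_force_sq_le:
  assumes "x \<in> cell"
  shows "(vertical_force x)\<^sup>2 \<le> 6 * M * energy x"
proof -
  have "(vertical_force x)\<^sup>2 \<le> 2 * (convection u u x $ 3)\<^sup>2 + 2 * (convection h h x $ 3)\<^sup>2"
    using zero_le_power2[of "convection u u x $ 3 + convection h h x $ 3"]
    by (simp add: vertical_force_def power2_eq_square algebra_simps)
  moreover have y: "(y $ 3)\<^sup>2 \<le> (norm y)\<^sup>2" for y :: "real^3"
    by (simp add: norm_sq_components sum_3)
  have "(norm (u x))\<^sup>2 * grad_sq u x \<le> M * grad_sq u x"
    "(norm (h x))\<^sup>2 * grad_sq h x \<le> M * grad_sq h x"
    by (intro mult_right_mono U.bounded H.bounded assms grad_sq_nonneg)+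
  then have "(convection u u x $ 3)\<^sup>2 \<le> 3 * (M * grad_sq u x)"
    "(convection h h x $ 3)\<^sup>2 \<le> 3 * (M * grad_sq h x)"
    using y[of "convection u u x"] norm_convection_sq_le[of u u x]
      y[of "convection h h x"] norm_convection_sq_le[of h h x]
    unfolding mult.assoc by linarith+
  ultimately show ?thesis
    by (simp add: energy_def algebra_simps)
qed

lemma vertical_momentum:
  "partial 3 p x - laplacian u x $ 3 = - vertical_force x"
proof -
  have "(convection u u x + gradient p x - convection h h x - laplacian u x) $ 3 = 0"
    by (simp add: momentum)
  then show ?thesis by (simp add: gradient_def vertical_force_def)
qed

lemma laplacian_component: "laplacian u x $ k = (\<Sum>i\<in>UNIV. partial i (partial i u) x $ k)"
  by (simp add: laplacian_def)

text \<open>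
  The third momentum equation says \<open>\<partial>\<^sub>3 p - \<Delta>u\<^sub>3 = - vertical_force\<close>, so that the field with
  components \<open>w (\<delta>\<^sub>i\<^sub>3 q - \<partial>\<^sub>i u\<^sub>3)\<close> has a divergence without second derivatives of \<open>u\<close>. It
  is used twice: with \<open>w = 1\<close> and the periodic part \<open>q\<close> of the pressure to find its linear part \<open>c\<close>,
  and with \<open>w\<close> the stream function and \<open>q = p\<close> to bound the pressure flux.
\<close>

lemma pressure_test:
  assumes w: "\<And>i. has_partial i w (w' i)" "continuous_on UNIV w" "\<And>i. continuous_on UNIV (w' i)"
    and q: "has_partial 3 q (\<lambda>x. partial 3 p x - c)" "continuous_on UNIV q"
    and vertical: "\<And>x. x $ 3 = - pi \<Longrightarrow> w (x + axis 3 (2 * pi)) = w x"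
      "\<And>x. x $ 3 = - pi \<Longrightarrow> w x * q (x + axis 3 (2 * pi)) = w x * q x"
    and R: "R > 0"
  shows "integral (slab R) (\<lambda>x. cutoff 2 R x * (w' 3 x * q x - (\<Sum>i\<in>UNIV. w' i x * partial i u x $ 3)
      - w x * (vertical_force x + c)))
    = - (4 / R\<^sup>2) * integral (slab R) (\<lambda>x. cutoff 1 R x * (w x * radial_diffusion x))"
proof -
  define f where "f i x = w x * ((if i = 3 then q x else 0) - partial i u x $ 3)" for i x
  define f' where "f' i x = w' i x * ((if i = 3 then q x else 0) - partial i u x $ 3) +
      w x * ((if i = 3 then partial 3 p x - c else 0) - partial i (partial i u) x $ 3)" for i x
  have D: "has_partial i (f i) (f' i)" for i
  proof (cases "i = 3")
    case True
    then show ?thesis unfolding f_def f'_def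
      using q(1) by (auto intro!: has_partial_mult w has_partial_diff has_partial_component
          smooth_partial U.smooth)
  next
    case False
    then show ?thesis unfolding f_def f'_def
      by (auto intro!: has_partial_mult w has_partial_diff has_partial_component has_partial_const
          smooth_partial U.smooth simp del: diff_0)
  qed
  have cf: "continuous_on UNIV (f i)" for i
    unfolding f_def by (cases "i = 3") (auto intro!: continuous_intros w q continuous_fields)
  have cf': "continuous_on UNIV (f' i)" for i
    unfolding f'_def by (cases "i = 3") (auto intro!: continuous_intros w q continuous_fields)
  have v: "f 3 (x + axis 3 (2 * pi)) = f 3 x" if "x $ 3 = - pi" for x
    using vertical[OF that] periodic_partial[OF U.smooth U.periodic, of 3]
    by (simp add: f_def periodic_z_def right_diff_distrib)
  have sum: "(\<Sum>i\<in>UNIV. f' i x) = w' 3 x * q x - (\<Sum>i\<in>UNIV. w' i x * partial i u x $ 3)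
      - w x * (vertical_force x + c)" for x
  proof -
    have "(\<Sum>i\<in>UNIV. f' i x) = w' 3 x * q x - (\<Sum>i\<in>UNIV. w' i x * partial i u x $ 3)
       + w x * ((partial 3 p x - laplacian u x $ 3) - c)"
      by (simp add: f'_def sum_3 laplacian_component algebra_simps)
    then show ?thesis by (simp add: vertical_momentum algebra_simps)
  qed
  have rhs: "x $ 1 * f 1 x + x $ 2 * f 2 x = - (w x * radial_diffusion x)" for x
    by (simp add: f_def radial_diffusion_def algebra_simps)
  show ?thesis
    using integral_cutoff_divergence[of f f' R 0, OF D cf cf' v R]
    by (simp add: sum rhs numeral_2_eq_2[symmetric])
qed

text \<open>
  The fluxes \<open>f i\<close> are chosen so that their divergence is \<open>u\<close> times the momentum equation plus \<open>h\<close> times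
  the induction equation, minus the energy density: the terms \<open>h \<cdot> (h \<cdot> \<nabla>u)\<close> and \<open>u \<cdot> (h \<cdot> \<nabla>h)\<close>
  add up to the divergence of \<open>(u \<cdot> h) h\<close>.
\<close>

lemma energy_identity:
  assumes per: "periodic_z p" and R: "R > 0"
  shows "integral (slab R) (\<lambda>x. cutoff 3 R x * energy x) = - (6 / R\<^sup>2) *
    integral (slab R) (\<lambda>x. cutoff 2 R x *
      (field_sq x / 2 * radial u x + p x * radial u x - (u x \<bullet> h x) * radial h x
       - (x $ 1 * (u x \<bullet> partial 1 u x + h x \<bullet> partial 1 h x)
        + x $ 2 * (u x \<bullet> partial 2 u x + h x \<bullet> partial 2 h x))))"
proof -
  define f where "f i x = (1 / 2) * (u x \<bullet> u x + h x \<bullet> h x) * u x $ i + p x * u x $ i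
      - (u x \<bullet> h x) * h x $ i - (u x \<bullet> partial i u x + h x \<bullet> partial i h x)" for i x
  define f' where "f' i x =
      ((1 / 2) * ((partial i u x \<bullet> u x + u x \<bullet> partial i u x)
         + (partial i h x \<bullet> h x + h x \<bullet> partial i h x)) * u x $ i
         + (1 / 2) * (u x \<bullet> u x + h x \<bullet> h x) * partial i u x $ i)
      + (partial i p x * u x $ i + p x * partial i u x $ i)
      - ((partial i u x \<bullet> h x + u x \<bullet> partial i h x) * h x $ i + (u x \<bullet> h x) * partial i h x $ i)
      - ((partial i u x \<bullet> partial i u x + u x \<bullet> partial i (partial i u) x)
         + (partial i h x \<bullet> partial i h x + h x \<bullet> partial i (partial i h) x))" for i x
  have D: "has_partial i (f i) (f' i)" for i
    unfolding f_def f'_def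
    by (intro has_partial_diff has_partial_add has_partial_mult has_partial_cmult has_partial_inner
        has_partial_component has_partial_smooth smooth_partial U.smooth H.smooth smooth_p)
  have cf: "continuous_on UNIV (f i)" for i
    unfolding f_def by (intro continuous_intros continuous_fields)
  have cf': "continuous_on UNIV (f' i)" for i
    unfolding f'_def by (intro continuous_intros continuous_fields)
  have v: "f 3 (x + axis 3 (2 * pi)) = f 3 x" for x
    using U.periodic H.periodic per periodic_partial[OF U.smooth U.periodic, of 3]
      periodic_partial[OF H.smooth H.periodic, of 3]
    by (simp add: f_def periodic_z_def)
  have sum: "(\<Sum>i\<in>UNIV. f' i x) = - energy x" for x
  proof -
    have 1: "u x \<bullet> (convection u u x + gradient p x - convection h h x - laplacian u x) = 0"
      by (simp add: momentum)
    have 2: "h x \<bullet> (convection u h x - convection h u x - laplacian h x) = 0"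
      by (simp add: induction)
    have gp: "u x \<bullet> gradient p x = (\<Sum>i\<in>UNIV. partial i p x * u x $ i)"
      by (simp add: inner_vec_def gradient_def mult.commute)
    have du: "partial 3 u x $ 3 = - partial 1 u x $ 1 - partial 2 u x $ 2"
      using U.solenoidal[of x] divergence_components[OF U.smooth, of x] by simp
    have dh: "partial 3 h x $ 3 = - partial 1 h x $ 1 - partial 2 h x $ 2"
      using H.solenoidal[of x] divergence_components[OF H.smooth, of x] by simp
    have e: "energy x = (\<Sum>i\<in>UNIV. partial i u x \<bullet> partial i u x + partial i h x \<bullet> partial i h x)"
      by (simp add: energy_def grad_sq_def power2_norm_eq_inner sum.distrib)
    show ?thesis
      using 1 2 unfolding e f'_def
      by (simp add: sum_3 inner_add_right inner_diff_right gp convection_def laplacian_def du dh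
          add_divide_distrib diff_divide_distrib algebra_simps inner_commute)
  qed
  have rhs: "x $ 1 * f 1 x + x $ 2 * f 2 x = field_sq x / 2 * radial u x + p x * radial u x
       - (u x \<bullet> h x) * radial h x
       - (x $ 1 * (u x \<bullet> partial 1 u x + h x \<bullet> partial 1 h x)
        + x $ 2 * (u x \<bullet> partial 2 u x + h x \<bullet> partial 2 h x))" for x
    by (simp add: f_def radial_def field_sq_def power2_norm_eq_inner add_divide_distrib algebra_simps)
  show ?thesis
    using integral_cutoff_divergence[of f f' R 1, OF D cf cf' v R]
    by (simp add: sum rhs eval_nat_numeral)
qed

end

section \<open>Estimates\<close>

lemma integral_slab_abs_le:
  fixes f g :: "real^3 \<Rightarrow> real"
  assumes "continuous_on UNIV f" "continuous_on UNIV g" "\<And>x. x \<in> slab R \<Longrightarrow> \<bar>f x\<bar> \<le> g x"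
  shows "\<bar>integral (slab R) f\<bar> \<le> integral (slab R) g"
  using integral_norm_bound_integral[OF integrable_slab[OF assms(1)] integrable_slab[OF assms(2)]] assms(3)
  by simp

lemma integral_slab_subset_le:
  fixes f :: "real^3 \<Rightarrow> real"
  assumes "continuous_on UNIV f" "\<And>x. 0 \<le> f x" "r \<le> R"
  shows "integral (slab r) f \<le> integral (slab R) f"
  using assms by (intro integral_subset_le integrable_slab) (auto simp: mem_slab)

lemma integral_cutoff_ge:
  assumes f: "continuous_on UNIV f" "\<And>x. 0 \<le> f x" and R: "R \<ge> 1"
  shows "(1 / 2) ^ n * integral (slab (R / 2)) f \<le> integral (slab R) (\<lambda>x. cutoff n R x * f x)"
proof -
  have c: "continuous_on UNIV (\<lambda>x. cutoff n R x * f x)"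
    by (intro continuous_intros continuous_cutoff f)
  have "(1 / 2) ^ n * integral (slab (R / 2)) f = integral (slab (R / 2)) (\<lambda>x. (1 / 2) ^ n * f x)"
    by simp
  also have "\<dots> \<le> integral (slab (R / 2)) (\<lambda>x. cutoff n R x * f x)"
    by (intro integral_slab_mono continuous_intros continuous_cutoff f mult_right_mono
        cutoff_lower_bound R)
  also have "\<dots> \<le> integral (slab R) (\<lambda>x. cutoff n R x * f x)"
    using R by (intro integral_slab_subset_le c) (auto simp: cutoff_nonneg f)
  finally show ?thesis .
qed

lemma young:
  fixes a b :: real
  assumes "s > 0"
  shows "\<bar>a * b\<bar> \<le> s * a\<^sup>2 + b\<^sup>2 / (4 * s)"
proof -
  have "0 \<le> (2 * s * \<bar>a\<bar> - \<bar>b\<bar>)\<^sup>2 / (4 * s)" using assms by simp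
  also have "\<dots> = s * a\<^sup>2 + b\<^sup>2 / (4 * s) - \<bar>a * b\<bar>"
    using assms by (simp add: power2_eq_square field_simps abs_mult)
  finally show ?thesis by simp
qed

lemma cutoff_abs_le: "\<bar>cutoff n R x * y\<bar> \<le> \<bar>y\<bar>"
  using mult_right_mono[OF cutoff_le_1[of n R x] abs_ge_zero[of y]]
  by (simp add: abs_mult cutoff_nonneg)

lemma has_partial_zero_imp_constant:
  assumes "\<And>i. has_partial i f (\<lambda>x. 0)"
  shows "f x = f 0"
proof -
  have line: "f (y + t *\<^sub>R axis i 1) = f y" for y t i
    using DERIV_isconst_all[of "\<lambda>t. f (y + t *\<^sub>R axis i 1)" t 0]
      has_partial_along_line[OF assms[of i], of y] by simp
  have "x = 0 + (x $ 1) *\<^sub>R axis 1 1 + (x $ 2) *\<^sub>R axis 2 1 + (x $ 3) *\<^sub>R axis 3 1"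
    by (simp add: vec_eq_iff forall_3 axis_def)
  then show ?thesis by (metis line)
qed

context mhd_solution
begin

lemma radial_diffusion_sq_le:
  assumes "x \<in> slab R"
  shows "(radial_diffusion x)\<^sup>2 \<le> 2 * R\<^sup>2 * energy x"
proof -
  have "(x $ 1)\<^sup>2 \<le> R\<^sup>2" "(x $ 2)\<^sup>2 \<le> R\<^sup>2"
    using assms by (auto simp: mem_slab intro: abs_le_square_iff[THEN iffD1])
  moreover have "(partial 1 u x $ 3)\<^sup>2 + (partial 2 u x $ 3)\<^sup>2 \<le> energy x"
    using grad_sq_nonneg[of h x]
    by (simp add: energy_def grad_sq_components[of u] sum_3)
  ultimately have "((x $ 1)\<^sup>2 + (x $ 2)\<^sup>2) * ((partial 1 u x $ 3)\<^sup>2 + (partial 2 u x $ 3)\<^sup>2)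
      \<le> (2 * R\<^sup>2) * energy x"
    by (intro mult_mono) auto
  then show ?thesis
    unfolding radial_diffusion_def using cauchy_schwarz_2 order_trans by blast
qed

lemma partial_p_periodic: "partial i p (x + axis 3 (2 * pi)) = partial i p x"
proof -
  have g: "gradient p y = convection h h y + laplacian u y - convection u u y" for y
    using momentum[of y] by (simp add: algebra_simps)
  have "gradient p (x + axis 3 (2 * pi)) = gradient p x"
    by (simp add: g periodic_convection periodic_laplacian U.smooth H.smooth U.periodic H.periodic)
  then show ?thesis by (simp add: gradient_def vec_eq_iff)
qed

text \<open>
  The increment of \<open>p\<close> over a period is constant because \<open>\<nabla>p\<close> is periodic; dividing it by \<open>2 \<pi>\<close>
  gives the slope \<open>c\<close> of the linear part. In the tested third equation, \<open>c\<close> is multiplied by the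
  integral of the cut-off, of order \<open>R\<^sup>2\<close>, while all other terms are of order \<open>R\<close> by the
  Dirichlet bound and boundedness of the fields.
\<close>

lemma pressure_periodic: "periodic_z p"
proof -
  define d where "d x = p (x + axis 3 (2 * pi)) - p x" for x
  have "has_partial i d (\<lambda>x. 0)" for i
  proof -
    have s: "has_partial i (\<lambda>x. p (x + axis 3 (2 * pi))) (\<lambda>x. partial i p (x + axis 3 (2 * pi)))"
      unfolding has_partial_def
    proof
      fix y
      have "y + t *\<^sub>R axis i 1 + axis 3 (2 * pi) = (y + axis 3 (2 * pi)) + t *\<^sub>R axis i 1" for t
        by simp
      then show "((\<lambda>t. p (y + t *\<^sub>R axis i 1 + axis 3 (2 * pi))) has_real_derivative
          partial i p (y + axis 3 (2 * pi))) (at 0)"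
        using has_partial_smooth[OF smooth_p, of i] by (simp only: has_partial_def)
    qed
    from has_partial_diff[OF s has_partial_smooth[OF smooth_p, of i]]
    show ?thesis by (simp add: d_def[abs_def] partial_p_periodic)
  qed
  then have d: "d x = d 0" for x by (rule has_partial_zero_imp_constant)
  define c where "c = d 0 / (2 * pi)"
  define q where "q x = p x - c * x $ 3" for x
  have q: "has_partial 3 q (\<lambda>x. partial 3 p x - c)"
    using has_partial_diff[OF has_partial_smooth[OF smooth_p, of 3] has_partial_cmult[OF has_partial_coord[of 3 3], of c]]
    by (simp add: q_def[abs_def])
  have cq: "continuous_on UNIV q"
    unfolding q_def by (intro continuous_intros continuous_fields)
  have qper: "q (x + axis 3 (2 * pi)) = q x" for x
  proof -
    have "c * (2 * pi) = d x" unfolding d[of x] by (simp add: c_def)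
    then have "p (x + axis 3 (2 * pi)) = p x + c * (2 * pi)" by (simp add: d_def)
    moreover have "(x + axis 3 (2 * pi)) $ 3 = x $ 3 + 2 * pi" by (simp add: axis_def)
    ultimately show ?thesis by (simp only: q_def) (simp add: algebra_simps)
  qed
  define K where "K = 24 * pi + (4 + 3 * M) * (2 * E)"
  have bound: "\<bar>c\<bar> * R \<le> K" if R: "R \<ge> 1" for R
  proof -
    have R0: "R > 0" using R by simp
    let ?F = "\<lambda>x. (4 / R\<^sup>2) * (cutoff 1 R x * radial_diffusion x) - cutoff 2 R x * vertical_force x"
    have c1: "continuous_on UNIV (\<lambda>x. cutoff n R x * radial_diffusion x)" for n
      by (intro continuous_intros continuous_cutoff continuous_radial_diffusion)
    have c2: "continuous_on UNIV (\<lambda>x. cutoff n R x * vertical_force x)" for n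
      by (intro continuous_intros continuous_cutoff continuous_vertical_force)
    have "integral (slab R) (\<lambda>x. cutoff 2 R x * (- (vertical_force x + c)))
        = - (4 / R\<^sup>2) * integral (slab R) (\<lambda>x. cutoff 1 R x * radial_diffusion x)"
      using pressure_test[of "\<lambda>x. 1" "\<lambda>i x. 0" q c R] q cq qper R0
      by (simp add: has_partial_const)
    moreover have "integral (slab R) (\<lambda>x. cutoff 2 R x * (- (vertical_force x + c))) =
        integral (slab R) (\<lambda>x. - (cutoff 2 R x * vertical_force x) - c * cutoff 2 R x)"
      by (rule arg_cong[where f = "integral (slab R)"]) (simp add: fun_eq_iff algebra_simps)
    moreover have "\<dots> = integral (slab R) (\<lambda>x. - (cutoff 2 R x * vertical_force x)) -
        integral (slab R) (\<lambda>x. c * cutoff 2 R x)"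
      by (intro integral_diff integrable_slab continuous_intros c2 continuous_cutoff)
    moreover have "integral (slab R) ?F = integral (slab R) (\<lambda>x. (4 / R\<^sup>2) * (cutoff 1 R x * radial_diffusion x)) -
        integral (slab R) (\<lambda>x. cutoff 2 R x * vertical_force x)"
      by (intro integral_diff integrable_slab continuous_intros c2 continuous_cutoff
          continuous_radial_diffusion)
    ultimately have "c * integral (slab R) (cutoff 2 R) = integral (slab R) ?F"
      by simp
    moreover have "\<bar>integral (slab R) ?F\<bar> \<le> integral (slab R) (\<lambda>x. 3 / R + (4 + 3 * M) * R * energy x)"
    proof (rule integral_slab_abs_le)
      fix x assume x: "x \<in> slab R"
      have "\<bar>cutoff 1 R x * radial_diffusion x\<bar> \<le> \<bar>1 * radial_diffusion x\<bar>"
        by (simp add: cutoff_abs_le)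
      also have "\<dots> \<le> R / 2 + (radial_diffusion x)\<^sup>2 / (2 * R)"
        using young[of "R / 2" 1 "radial_diffusion x"] R0 by simp
      also have "\<dots> \<le> R / 2 + (2 * R\<^sup>2 * energy x) / (2 * R)"
        using R0 by (intro add_left_mono divide_right_mono radial_diffusion_sq_le x) auto
      also have "\<dots> = R / 2 + R * energy x" using R0 by (simp add: power2_eq_square)
      finally have "(4 / R\<^sup>2) * \<bar>cutoff 1 R x * radial_diffusion x\<bar> \<le> (4 / R\<^sup>2) * (R / 2 + R * energy x)"
        by (intro mult_left_mono) auto
      also have "\<dots> = 2 / R + 4 * (energy x / R)"
        using R0 by (simp add: power2_eq_square field_simps)
      also have "energy x / R \<le> R * energy x"
      proof -
        have "energy x * 1 \<le> energy x * (R * R)"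
          using energy_nonneg[of x] mult_mono[of 1 R 1 R] R by (intro mult_left_mono) auto
        then show ?thesis using R0 by (simp add: divide_le_eq mult_ac)
      qed
      finally have A: "(4 / R\<^sup>2) * \<bar>cutoff 1 R x * radial_diffusion x\<bar> \<le> 2 / R + 4 * (R * energy x)"
        by simp
      have "\<bar>cutoff 2 R x * vertical_force x\<bar> \<le> \<bar>1 * vertical_force x\<bar>"
        by (simp add: cutoff_abs_le)
      also have "\<dots> \<le> 1 / (2 * R) + R / 2 * (vertical_force x)\<^sup>2"
        using young[of "1 / (2 * R)" 1 "vertical_force x"] R0 by (simp add: mult_ac)
      also have "\<dots> \<le> 1 / R + R / 2 * (6 * M * energy x)"
        using R0 x slab_subset_cell by (intro add_mono mult_left_mono vertical_force_sq_le)
          (auto simp: field_simps)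
      finally have B: "\<bar>cutoff 2 R x * vertical_force x\<bar> \<le> 1 / R + 3 * M * (R * energy x)"
        by (simp add: mult_ac)
      have "\<bar>?F x\<bar> \<le> (4 / R\<^sup>2) * \<bar>cutoff 1 R x * radial_diffusion x\<bar> + \<bar>cutoff 2 R x * vertical_force x\<bar>"
        using abs_triangle_ineq4[of "(4 / R\<^sup>2) * (cutoff 1 R x * radial_diffusion x)" "cutoff 2 R x * vertical_force x"]
        by (simp add: abs_mult)
      then show "\<bar>?F x\<bar> \<le> 3 / R + (4 + 3 * M) * R * energy x"
        using A B by (simp add: algebra_simps)
    qed (intro continuous_intros c2 continuous_cutoff continuous_radial_diffusion continuous_energy)+
    moreover have "integral (slab R) (\<lambda>x. 3 / R + (4 + 3 * M) * R * energy x) =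
       integral (slab R) (\<lambda>x. 3 / R) + integral (slab R) (\<lambda>x. (4 + 3 * M) * R * energy x)"
      by (intro integral_add integrable_slab continuous_intros continuous_energy)
    moreover have "\<dots> \<le> 24 * pi * R + (4 + 3 * M) * R * (2 * E)"
      using mult_left_mono[OF integral_energy_le[OF R], of "(4 + 3 * M) * R"] R0 M_nonneg
      by (subst integral_slab_const) (auto simp: power2_eq_square)
    ultimately have "\<bar>c * integral (slab R) (cutoff 2 R)\<bar> \<le> K * R"
      by (simp add: K_def algebra_simps)
    moreover have "pi / 2 * R\<^sup>2 \<le> integral (slab R) (cutoff 2 R)"
      using integral_cutoff_ge[of "\<lambda>x. 1" R 2] R integral_slab_const[of "R / 2" 1]
      by (simp add: power2_eq_square mult_ac)
    then have "\<bar>c\<bar> * (pi / 2 * R\<^sup>2) \<le> \<bar>c\<bar> * integral (slab R) (cutoff 2 R)"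
      by (intro mult_left_mono) auto
    moreover have "\<bar>c\<bar> * (1 * R\<^sup>2) \<le> \<bar>c\<bar> * (pi / 2 * R\<^sup>2)"
      using pi_ge_two by (intro mult_left_mono mult_right_mono) auto
    moreover have "0 \<le> integral (slab R) (cutoff 2 R)"
      by (intro integral_nonneg integrable_slab continuous_cutoff cutoff_nonneg)
    ultimately have "(\<bar>c\<bar> * R) * R \<le> K * R"
      by (simp add: abs_mult power2_eq_square mult_ac)
    then show ?thesis using R0 by simp
  qed
  have "c = 0"
  proof (rule ccontr)
    assume c: "c \<noteq> 0"
    define R where "R = max 1 ((K + 1) / \<bar>c\<bar>)"
    have "\<bar>c\<bar> * R \<ge> \<bar>c\<bar> * ((K + 1) / \<bar>c\<bar>)"
      unfolding R_def by (intro mult_left_mono) auto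
    then show False using bound[of R] c by (simp add: R_def)
  qed
  then have "d x = 0" for x using d[of x] by (simp add: c_def)
  then show ?thesis by (simp add: periodic_z_def d_def)
qed

text \<open>
  The summands stem from the gradient of the stream function, from the stream function, and from the
  energy, in the majorant used for \<open>pressure_flux_le\<close>.
\<close>

definition pressure_bound :: real where
  "pressure_bound = 3 / 2 * (64 * pi ^ 3 * M + 16 * pi\<^sup>2 * E) + 3 * (32 * pi ^ 4 * E)
     + (5 + 3 * M) * (2 * E)"

text \<open>
  After \<open>pressure_test\<close> every term is a product of the stream function or its gradient, of
  \<open>L\<^sup>2\<close>-size \<open>R\<close>, with a factor of bounded \<open>L\<^sup>2\<close>-norm; \<open>radial_diffusion\<close>, itself of size \<open>R\<close>, comes
  with the weight \<open>4 / R\<^sup>2\<close>. Young's inequality with weight \<open>1 / R\<close>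
  balances the two.
\<close>

lemma pressure_flux_le:
  assumes R: "R \<ge> 1"
  shows "\<bar>integral (slab R) (\<lambda>x. cutoff 2 R x * (p x * radial u x))\<bar> \<le> pressure_bound * R"
proof -
  have R0: "R > 0" using R by simp
  let ?sp = "U.stream_partial"
  let ?A = "\<lambda>x. (\<Sum>i\<in>UNIV. ?sp i x * partial i u x $ 3) + U.stream x * vertical_force x"
  let ?F = "\<lambda>x. cutoff 2 R x * ?A x - (4 / R\<^sup>2) * (cutoff 1 R x * (U.stream x * radial_diffusion x))"
  let ?g = "\<lambda>x. (1 / (2 * R)) * (\<Sum>i\<in>UNIV. (?sp i x)\<^sup>2) + (3 / R) * (U.stream x)\<^sup>2
      + (5 + 3 * M) * R * energy x"
  have bt: "U.stream (x + axis 3 (2 * pi)) = 0" "U.stream x = 0" if "x $ 3 = - pi" for x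
    using that U.stream_top[of "x + axis 3 (2 * pi)"] U.stream_bottom[of x] by (auto simp: axis_def)
  have id: "integral (slab R) (\<lambda>x. cutoff 2 R x * (?sp 3 x * p x - (\<Sum>i\<in>UNIV. ?sp i x * partial i u x $ 3)
      - U.stream x * (vertical_force x + 0)))
    = - (4 / R\<^sup>2) * integral (slab R) (\<lambda>x. cutoff 1 R x * (U.stream x * radial_diffusion x))"
    using has_partial_smooth[OF smooth_p, of 3] bt R0
    by (intro pressure_test U.has_partial_stream U.continuous_stream U.continuous_stream_partial
        continuous_fields) auto
  have cA: "continuous_on UNIV ?A"
    by (intro continuous_intros continuous_fields U.continuous_stream U.continuous_stream_partial
        continuous_vertical_force)
  have c1: "continuous_on UNIV (\<lambda>x. cutoff 2 R x * ?A x)"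
    by (intro continuous_on_mult cA continuous_cutoff)
  have c2: "continuous_on UNIV (\<lambda>x. cutoff 1 R x * (U.stream x * radial_diffusion x))"
    by (intro continuous_on_mult continuous_cutoff U.continuous_stream continuous_radial_diffusion)
  have c3: "continuous_on UNIV (\<lambda>x. cutoff 2 R x * (p x * radial u x))"
    by (intro continuous_on_mult continuous_cutoff continuous_fields continuous_radial U.smooth)
  have "integral (slab R) (\<lambda>x. cutoff 2 R x * (p x * radial u x)) - integral (slab R) (\<lambda>x. cutoff 2 R x * ?A x)
      = integral (slab R) (\<lambda>x. cutoff 2 R x * (p x * radial u x) - cutoff 2 R x * ?A x)"
    by (intro integral_diff[symmetric] integrable_slab c1 c3)
  also have "\<dots> = - (4 / R\<^sup>2) * integral (slab R) (\<lambda>x. cutoff 1 R x * (U.stream x * radial_diffusion x))"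
    unfolding id[symmetric] by (simp add: U.stream_partial_def algebra_simps)
  finally have "integral (slab R) (\<lambda>x. cutoff 2 R x * (p x * radial u x)) =
      integral (slab R) (\<lambda>x. cutoff 2 R x * ?A x) -
      integral (slab R) (\<lambda>x. (4 / R\<^sup>2) * (cutoff 1 R x * (U.stream x * radial_diffusion x)))"
    by simp
  also have "\<dots> = integral (slab R) ?F"
    by (intro integral_diff[symmetric] integrable_slab c1 continuous_on_mult_left c2)
  finally have "\<bar>integral (slab R) (\<lambda>x. cutoff 2 R x * (p x * radial u x))\<bar> = \<bar>integral (slab R) ?F\<bar>"
    by simp
  also have "\<dots> \<le> integral (slab R) ?g"
  proof (rule integral_slab_abs_le)
    show "continuous_on UNIV ?F"
      by (intro continuous_on_diff c1 continuous_on_mult_left c2)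
    show "continuous_on UNIV ?g"
      by (intro continuous_intros U.continuous_stream U.continuous_stream_partial continuous_energy)
    fix x assume x: "x \<in> slab R"
    have 1: "\<bar>\<Sum>i\<in>UNIV. ?sp i x * partial i u x $ 3\<bar> \<le>
        (1 / (2 * R)) * (\<Sum>i\<in>UNIV. (?sp i x)\<^sup>2) + R * energy x"
    proof -
      have "\<bar>\<Sum>i\<in>UNIV. ?sp i x * partial i u x $ 3\<bar> \<le> (\<Sum>i\<in>UNIV. \<bar>?sp i x * partial i u x $ 3\<bar>)"
        by (rule sum_abs)
      also have "\<dots> \<le> (\<Sum>i\<in>UNIV. (1 / (2 * R)) * (?sp i x)\<^sup>2 + R / 2 * (partial i u x $ 3)\<^sup>2)"
        using young[of "1 / (2 * R)"] R0 by (intro sum_mono) (auto simp: mult_ac)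
      also have "\<dots> = (1 / (2 * R)) * (\<Sum>i\<in>UNIV. (?sp i x)\<^sup>2) + R / 2 * (\<Sum>i\<in>UNIV. (partial i u x $ 3)\<^sup>2)"
        by (simp add: sum.distrib sum_distrib_left)
      also have "R / 2 * (\<Sum>i\<in>UNIV. (partial i u x $ 3)\<^sup>2) \<le> R * energy x"
      proof -
        have "(\<Sum>i\<in>UNIV. (partial i u x $ 3)\<^sup>2) \<le> energy x"
          using grad_sq_nonneg[of h x] by (simp add: energy_def grad_sq_components[of u] sum_3)
        then have "R / 2 * (\<Sum>i\<in>UNIV. (partial i u x $ 3)\<^sup>2) \<le> R / 2 * energy x"
          using R0 by (intro mult_left_mono) auto
        then show ?thesis using mult_nonneg_nonneg[of R "energy x"] R0 energy_nonneg[of x] by simp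
      qed
      finally show ?thesis by simp
    qed
    have 2: "\<bar>U.stream x * vertical_force x\<bar> \<le> (1 / R) * (U.stream x)\<^sup>2 + 3 * M * (R * energy x)"
    proof -
      have "\<bar>U.stream x * vertical_force x\<bar> \<le> (1 / (2 * R)) * (U.stream x)\<^sup>2 + R / 2 * (vertical_force x)\<^sup>2"
        using young[of "1 / (2 * R)" "U.stream x" "vertical_force x"] R0 by (simp add: mult_ac)
      also have "\<dots> \<le> (1 / R) * (U.stream x)\<^sup>2 + R / 2 * (6 * M * energy x)"
        using R0 x slab_subset_cell by (intro add_mono mult_left_mono mult_right_mono vertical_force_sq_le)
          (auto simp: field_simps)
      finally show ?thesis by (simp add: mult_ac)
    qed
    have 3: "(4 / R\<^sup>2) * \<bar>U.stream x * radial_diffusion x\<bar> \<le> (2 / R) * (U.stream x)\<^sup>2 + 4 * (R * energy x)"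
    proof -
      have "\<bar>U.stream x * radial_diffusion x\<bar> \<le> (1 / 2) * (U.stream x)\<^sup>2 + (radial_diffusion x)\<^sup>2 / 2"
        using young[of "1 / 2" "U.stream x" "radial_diffusion x"] by simp
      also have "\<dots> \<le> (1 / 2) * (U.stream x)\<^sup>2 + (2 * R\<^sup>2 * energy x) / 2"
        by (intro add_left_mono divide_right_mono radial_diffusion_sq_le x) auto
      finally have "(4 / R\<^sup>2) * \<bar>U.stream x * radial_diffusion x\<bar> \<le>
          (4 / R\<^sup>2) * ((1 / 2) * (U.stream x)\<^sup>2 + (2 * R\<^sup>2 * energy x) / 2)"
        by (intro mult_left_mono) auto
      also have "\<dots> = (2 / R\<^sup>2) * (U.stream x)\<^sup>2 + 4 * energy x"
        using R0 by (simp add: field_simps)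
      also have "\<dots> \<le> (2 / R) * (U.stream x)\<^sup>2 + 4 * (R * energy x)"
      proof (intro add_mono mult_right_mono mult_left_mono)
        show "2 / R\<^sup>2 \<le> 2 / R" using R by (simp add: power2_eq_square field_simps)
        show "energy x \<le> R * energy x" using mult_right_mono[OF R energy_nonneg[of x]] by simp
      qed auto
      finally show ?thesis .
    qed
    have g: "?g x = ((1 / (2 * R)) * (\<Sum>i\<in>UNIV. (?sp i x)\<^sup>2) + R * energy x) +
        ((1 / R) * (U.stream x)\<^sup>2 + 3 * M * (R * energy x)) +
        ((2 / R) * (U.stream x)\<^sup>2 + 4 * (R * energy x))"
      by (simp add: algebra_simps)
    have F: "\<bar>a - (4 / R\<^sup>2) * b\<bar> \<le> \<bar>a'\<bar> + (4 / R\<^sup>2) * \<bar>b'\<bar>"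
      if "\<bar>a\<bar> \<le> \<bar>a'\<bar>" "\<bar>b\<bar> \<le> \<bar>b'\<bar>" for a a' b b' :: real
    proof -
      have "\<bar>(4 / R\<^sup>2) * b\<bar> \<le> (4 / R\<^sup>2) * \<bar>b'\<bar>"
        unfolding abs_mult by (intro mult_mono that) auto
      then show ?thesis using that(1) by linarith
    qed
    show "\<bar>?F x\<bar> \<le> ?g x"
      unfolding g
      using F[OF cutoff_abs_le[of 2 R x "?A x"]
          cutoff_abs_le[of 1 R x "U.stream x * radial_diffusion x"]] 1 2 3
        abs_triangle_ineq[of "\<Sum>i\<in>UNIV. ?sp i x * partial i u x $ 3" "U.stream x * vertical_force x"]
      by linarith
  qed
  also have "integral (slab R) ?g = integral (slab R) (\<lambda>x. (1 / (2 * R)) * (\<Sum>i\<in>UNIV. (?sp i x)\<^sup>2))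
      + integral (slab R) (\<lambda>x. (3 / R) * (U.stream x)\<^sup>2) + integral (slab R) (\<lambda>x. (5 + 3 * M) * R * energy x)"
    by (subst integral_add | intro refl integrable_slab continuous_intros U.continuous_stream
        U.continuous_stream_partial continuous_energy)+
  also have "\<dots> = (1 / (2 * R)) * (\<Sum>i\<in>UNIV. integral (slab R) (\<lambda>x. (?sp i x)\<^sup>2))
      + (3 / R) * integral (slab R) (\<lambda>x. (U.stream x)\<^sup>2) + (5 + 3 * M) * R * integral (slab R) energy"
    by (subst integral_sum[symmetric])
      (auto intro!: integrable_slab continuous_intros U.continuous_stream_partial)
  also have "\<dots> \<le> (1 / (2 * R)) * (\<Sum>i\<in>(UNIV :: 3 set). (64 * pi ^ 3 * M + 16 * pi\<^sup>2 * E) * R\<^sup>2)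
      + (3 / R) * (32 * pi ^ 4 * E * R\<^sup>2) + (5 + 3 * M) * R * (2 * E)"
    using R0 M_nonneg
    by (intro add_mono mult_left_mono sum_mono U.stream_partial_L2 U.stream_L2 R integral_energy_le) auto
  also have "\<dots> = pressure_bound * R"
    using R0 by (simp add: pressure_bound_def power2_eq_square field_simps)
  finally show ?thesis .
qed

text \<open>
  Pointwise form of the bound, with the Young parameter \<open>s\<close> on the moments and gradients and \<open>1 / s\<close>
  on the size of the fields. Boundedness reduces the quartic term \<open>field_sq\<^sup>2\<close> to \<open>2 M field_sq\<close>.
\<close>

lemma cubic_and_diffusive_flux_le:
  assumes x: "x \<in> slab R" and R: "R \<ge> 1" and s: "s > 0"
  shows "(6 / R\<^sup>2) * \<bar>field_sq x / 2 * radial u x - (u x \<bullet> h x) * radial h x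
       - (x $ 1 * (u x \<bullet> partial 1 u x + h x \<bullet> partial 1 h x)
        + x $ 2 * (u x \<bullet> partial 2 u x + h x \<bullet> partial 2 h x))\<bar> \<le>
    (3 * s / R\<^sup>2) * ((radial u x)\<^sup>2 + (radial h x)\<^sup>2) + 6 * s * energy x
      + ((3 * M + 3) / s) * (field_sq x / R\<^sup>2)"
proof -
  have R0: "R > 0" using R by simp
  have fM: "(field_sq x)\<^sup>2 \<le> 2 * M * field_sq x"
    using mult_right_mono[OF field_sq_le field_sq_nonneg, of x x] x slab_subset_cell
    by (auto simp: power2_eq_square)
  have cubic: "field_sq x / 2 * \<bar>g\<bar> \<le> s / 2 * g\<^sup>2 + M / (4 * s) * field_sq x" for g
  proof -
    have "\<bar>g * field_sq x\<bar> \<le> s * g\<^sup>2 + (field_sq x)\<^sup>2 / (4 * s)" by (rule young[OF s])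
    also have "\<dots> \<le> s * g\<^sup>2 + (2 * M * field_sq x) / (4 * s)"
      using s by (intro add_left_mono divide_right_mono fM) auto
    finally show ?thesis
      using field_sq_nonneg[of x] by (simp add: abs_mult mult_ac)
  qed
  have uh: "\<bar>u x \<bullet> h x\<bar> \<le> field_sq x / 2"
  proof -
    have "\<bar>u x \<bullet> h x\<bar> \<le> norm (u x) * norm (h x)" by (rule Cauchy_Schwarz_ineq2)
    also have "\<dots> \<le> field_sq x / 2"
      using young[of "1 / 2" "norm (u x)" "norm (h x)"] by (simp add: field_sq_def)
    finally show ?thesis .
  qed
  have diff: "\<bar>x $ i * (u x \<bullet> partial i u x + h x \<bullet> partial i h x)\<bar> \<le>
      s * R\<^sup>2 * ((norm (partial i u x))\<^sup>2 + (norm (partial i h x))\<^sup>2) + field_sq x / (4 * s)"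
    if i: "\<bar>x $ i\<bar> \<le> R" for i
  proof -
    have one: "R * \<bar>a \<bullet> b\<bar> \<le> s * R\<^sup>2 * (norm b)\<^sup>2 + (norm a)\<^sup>2 / (4 * s)" for a b :: "real^3"
    proof -
      have "R * \<bar>a \<bullet> b\<bar> \<le> R * (norm a * norm b)"
        using R0 by (intro mult_left_mono Cauchy_Schwarz_ineq2) auto
      also have "\<dots> = \<bar>(R * norm b) * norm a\<bar>" using R0 by (simp add: abs_mult mult_ac)
      also have "\<dots> \<le> s * (R * norm b)\<^sup>2 + (norm a)\<^sup>2 / (4 * s)" by (rule young[OF s])
      finally show ?thesis by (simp add: power_mult_distrib)
    qed
    have "\<bar>x $ i * (u x \<bullet> partial i u x + h x \<bullet> partial i h x)\<bar> \<le>
        R * \<bar>u x \<bullet> partial i u x + h x \<bullet> partial i h x\<bar>"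
      unfolding abs_mult by (intro mult_right_mono i) auto
    also have "\<dots> \<le> R * (\<bar>u x \<bullet> partial i u x\<bar> + \<bar>h x \<bullet> partial i h x\<bar>)"
      using R0 by (intro mult_left_mono abs_triangle_ineq) auto
    also have "\<dots> \<le> (s * R\<^sup>2 * (norm (partial i u x))\<^sup>2 + (norm (u x))\<^sup>2 / (4 * s)) +
        (s * R\<^sup>2 * (norm (partial i h x))\<^sup>2 + (norm (h x))\<^sup>2 / (4 * s))"
      unfolding distrib_left by (intro add_mono one)
    finally show ?thesis by (simp add: field_sq_def add_divide_distrib algebra_simps)
  qed
  let ?P = "field_sq x / 2 * radial u x" and ?Q = "(u x \<bullet> h x) * radial h x"
    and ?S = "x $ 1 * (u x \<bullet> partial 1 u x + h x \<bullet> partial 1 h x)"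
    and ?T = "x $ 2 * (u x \<bullet> partial 2 u x + h x \<bullet> partial 2 h x)"
  have P: "\<bar>?P\<bar> \<le> s / 2 * (radial u x)\<^sup>2 + M / (4 * s) * field_sq x"
    using cubic[of "radial u x"] field_sq_nonneg[of x] by (simp add: abs_mult)
  have "\<bar>?Q\<bar> \<le> field_sq x / 2 * \<bar>radial h x\<bar>"
    unfolding abs_mult by (intro mult_right_mono uh) auto
  then have Q: "\<bar>?Q\<bar> \<le> s / 2 * (radial h x)\<^sup>2 + M / (4 * s) * field_sq x"
    using cubic[of "radial h x"] by linarith
  have grads: "(norm (partial 1 u x))\<^sup>2 + (norm (partial 1 h x))\<^sup>2 +
      ((norm (partial 2 u x))\<^sup>2 + (norm (partial 2 h x))\<^sup>2) \<le> energy x"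
    by (simp add: energy_def grad_sq_def sum_3)
  have ST: "\<bar>?S\<bar> + \<bar>?T\<bar> \<le> s * R\<^sup>2 * energy x + field_sq x / (2 * s)"
  proof -
    have "\<bar>x $ 1\<bar> \<le> R" "\<bar>x $ 2\<bar> \<le> R" using x by (auto simp: mem_slab)
    then have "\<bar>?S\<bar> + \<bar>?T\<bar> \<le> s * R\<^sup>2 * ((norm (partial 1 u x))\<^sup>2 + (norm (partial 1 h x))\<^sup>2 +
      ((norm (partial 2 u x))\<^sup>2 + (norm (partial 2 h x))\<^sup>2)) + field_sq x / (2 * s)"
      using diff[of 1] diff[of 2] by (simp add: distrib_left)
    also have "\<dots> \<le> s * R\<^sup>2 * energy x + field_sq x / (2 * s)"
      using s by (intro add_right_mono mult_left_mono grads) auto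
    finally show ?thesis .
  qed
  have "\<bar>?P - ?Q - (?S + ?T)\<bar> \<le> \<bar>?P\<bar> + \<bar>?Q\<bar> + (\<bar>?S\<bar> + \<bar>?T\<bar>)"
    by linarith
  also have "\<dots> \<le> (s / 2 * (radial u x)\<^sup>2 + M / (4 * s) * field_sq x) +
      (s / 2 * (radial h x)\<^sup>2 + M / (4 * s) * field_sq x) + (s * R\<^sup>2 * energy x + field_sq x / (2 * s))"
    by (intro add_mono P Q ST)
  finally have "(6 / R\<^sup>2) * \<bar>?P - ?Q - (?S + ?T)\<bar> \<le> (6 / R\<^sup>2) *
      ((s / 2 * (radial u x)\<^sup>2 + M / (4 * s) * field_sq x) +
      (s / 2 * (radial h x)\<^sup>2 + M / (4 * s) * field_sq x) + (s * R\<^sup>2 * energy x + field_sq x / (2 * s)))"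
    by (intro mult_left_mono) auto
  also have "\<dots> = (3 * s / R\<^sup>2) * ((radial u x)\<^sup>2 + (radial h x)\<^sup>2) + 6 * s * energy x
      + ((3 * M + 3) / s) * (field_sq x / R\<^sup>2)"
    using R0 s by (simp add: field_simps)
  finally show ?thesis .
qed

lemma energy_estimate:
  assumes R: "R \<ge> 1" and s: "s > 0"
  shows "integral (slab R) (\<lambda>x. cutoff 3 R x * energy x) \<le>
    s * (48 * pi\<^sup>2 * E + 12 * E) + (3 * M + 3) / s * (integral (slab R) field_sq / R\<^sup>2)
     + 6 * pressure_bound / R"
proof -
  have R0: "R > 0" using R by simp
  let ?B = "\<lambda>x. field_sq x / 2 * radial u x - (u x \<bullet> h x) * radial h x
       - (x $ 1 * (u x \<bullet> partial 1 u x + h x \<bullet> partial 1 h x)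
        + x $ 2 * (u x \<bullet> partial 2 u x + h x \<bullet> partial 2 h x))"
  let ?g = "\<lambda>x. (3 * s / R\<^sup>2) * ((radial u x)\<^sup>2 + (radial h x)\<^sup>2) + 6 * s * energy x
      + ((3 * M + 3) / s / R\<^sup>2) * field_sq x"
  have cB: "continuous_on UNIV (\<lambda>x. cutoff 2 R x * ?B x)"
    unfolding divide_inverse
    by (intro continuous_intros continuous_cutoff continuous_field_sq continuous_radial U.smooth H.smooth
        continuous_fields)
  have cp: "continuous_on UNIV (\<lambda>x. cutoff 2 R x * (p x * radial u x))"
    by (intro continuous_on_mult continuous_cutoff continuous_fields continuous_radial U.smooth)
  have "integral (slab R) (\<lambda>x. cutoff 3 R x * energy x) = - (6 / R\<^sup>2) *
      integral (slab R) (\<lambda>x. cutoff 2 R x * ?B x + cutoff 2 R x * (p x * radial u x))"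
    unfolding energy_identity[OF pressure_periodic R0] by (simp add: algebra_simps)
  moreover have "integral (slab R) (\<lambda>x. cutoff 2 R x * ?B x + cutoff 2 R x * (p x * radial u x)) =
      integral (slab R) (\<lambda>x. cutoff 2 R x * ?B x) + integral (slab R) (\<lambda>x. cutoff 2 R x * (p x * radial u x))"
    by (intro integral_add integrable_slab cB cp)
  ultimately have id: "integral (slab R) (\<lambda>x. cutoff 3 R x * energy x) =
      - integral (slab R) (\<lambda>x. (6 / R\<^sup>2) * (cutoff 2 R x * ?B x))
      - (6 / R\<^sup>2) * integral (slab R) (\<lambda>x. cutoff 2 R x * (p x * radial u x))"
    unfolding integral_mult_right by (simp only: distrib_left mult_minus_left minus_add_distrib
        diff_conv_add_uminus)
  have B: "\<bar>integral (slab R) (\<lambda>x. (6 / R\<^sup>2) * (cutoff 2 R x * ?B x))\<bar> \<le> integral (slab R) ?g"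
  proof (rule integral_slab_abs_le)
    show "continuous_on UNIV (\<lambda>x. (6 / R\<^sup>2) * (cutoff 2 R x * ?B x))"
      by (intro continuous_on_mult_left cB)
    show "continuous_on UNIV ?g"
      by (intro continuous_intros continuous_radial continuous_energy continuous_field_sq U.smooth H.smooth)
    fix x assume x: "x \<in> slab R"
    have "\<bar>(6 / R\<^sup>2) * (cutoff 2 R x * ?B x)\<bar> = (6 / R\<^sup>2) * \<bar>cutoff 2 R x * ?B x\<bar>"
      unfolding abs_mult[of "6 / R\<^sup>2"] by simp
    moreover have "(6 / R\<^sup>2) * \<bar>cutoff 2 R x * ?B x\<bar> \<le> (6 / R\<^sup>2) * \<bar>?B x\<bar>"
      by (intro mult_left_mono cutoff_abs_le) auto
    ultimately show "\<bar>(6 / R\<^sup>2) * (cutoff 2 R x * ?B x)\<bar> \<le> ?g x"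
      using cubic_and_diffusive_flux_le[OF x R s] by simp
  qed
  have P: "- ((6 / R\<^sup>2) * integral (slab R) (\<lambda>x. cutoff 2 R x * (p x * radial u x))) \<le> 6 * pressure_bound / R"
  proof -
    have "(6 / R\<^sup>2) * - integral (slab R) (\<lambda>x. cutoff 2 R x * (p x * radial u x)) \<le>
        (6 / R\<^sup>2) * (pressure_bound * R)"
      using pressure_flux_le[OF R] by (intro mult_left_mono) auto
    then show ?thesis using R0 by (simp add: power2_eq_square)
  qed
  have g: "integral (slab R) ?g = (3 * s / R\<^sup>2) * (integral (slab R) (\<lambda>x. (radial u x)\<^sup>2)
      + integral (slab R) (\<lambda>x. (radial h x)\<^sup>2)) + 6 * s * integral (slab R) energy
      + ((3 * M + 3) / s / R\<^sup>2) * integral (slab R) field_sq"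
  proof -
    have i: "(\<lambda>x. (radial u x)\<^sup>2) integrable_on slab R" "(\<lambda>x. (radial h x)\<^sup>2) integrable_on slab R"
      "energy integrable_on slab R" "field_sq integrable_on slab R"
      by (intro integrable_slab continuous_intros continuous_radial continuous_energy
          continuous_field_sq U.smooth H.smooth)+
    have "(?g has_integral (3 * s / R\<^sup>2) * (integral (slab R) (\<lambda>x. (radial u x)\<^sup>2)
      + integral (slab R) (\<lambda>x. (radial h x)\<^sup>2)) + 6 * s * integral (slab R) energy
      + ((3 * M + 3) / s / R\<^sup>2) * integral (slab R) field_sq) (slab R)"
      by (intro has_integral_add has_integral_mult_right integrable_integral i)
    then show ?thesis by (rule integral_unique)
  qed
  have "(3 * s / R\<^sup>2) * (integral (slab R) (\<lambda>x. (radial u x)\<^sup>2)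
      + integral (slab R) (\<lambda>x. (radial h x)\<^sup>2)) + 6 * s * integral (slab R) energy
      + ((3 * M + 3) / s / R\<^sup>2) * integral (slab R) field_sq \<le> (3 * s / R\<^sup>2) * (8 * pi\<^sup>2 * E * R\<^sup>2 + 8 * pi\<^sup>2 * E * R\<^sup>2) + 6 * s * (2 * E)
      + ((3 * M + 3) / s / R\<^sup>2) * integral (slab R) field_sq"
    using s M_nonneg by (intro add_mono mult_left_mono U.radial_L2 H.radial_L2 integral_energy_le R) auto
  also have "\<dots> = s * (48 * pi\<^sup>2 * E + 12 * E) + (3 * M + 3) / s * (integral (slab R) field_sq / R\<^sup>2)"
    using R0 by (simp add: algebra_simps)
  finally have "integral (slab R) ?g \<le> s * (48 * pi\<^sup>2 * E + 12 * E)
      + (3 * M + 3) / s * (integral (slab R) field_sq / R\<^sup>2)"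
    unfolding g .
  then show ?thesis unfolding id using B P by linarith
qed

text \<open>
  If the energy in a fixed slab were \<open>a > 0\<close>, the cut-off energy would stay above \<open>a / 8\<close> for large \<open>R\<close>,
  since the cut-off is at least \<open>(1/2)\<^sup>3\<close> on the slab of half the size. The parameters \<open>s\<close>, \<open>\<epsilon>\<close>
  and \<open>R\<close>, chosen in this order, make each of the three error terms at most \<open>a / 32\<close>.
\<close>

lemma energy_vanishes:
  assumes decay: "\<And>\<epsilon>. \<epsilon> > 0 \<Longrightarrow> \<exists>R0. \<forall>R\<ge>R0. integral (slab R) field_sq \<le> \<epsilon> * R\<^sup>2"
    and r: "r \<ge> 1"
  shows "integral (slab r) energy = 0"
proof (rule ccontr)
  define a where "a = integral (slab r) energy"
  assume "integral (slab r) energy \<noteq> 0"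
  moreover have "0 \<le> integral (slab r) energy"
    by (intro integral_nonneg integrable_slab continuous_energy energy_nonneg)
  ultimately have a: "a > 0" by (simp add: a_def)
  define C1 where "C1 = 48 * pi\<^sup>2 * E + 12 * E"
  define C2 where "C2 = 3 * M + 3"
  have C1: "C1 \<ge> 0" using E_nonneg by (simp add: C1_def)
  have C2: "C2 > 0" using M_nonneg by (simp add: C2_def)
  define s where "s = a / 32 / (C1 + 1)"
  have s: "s > 0" using a C1 by (simp add: s_def)
  define \<epsilon> where "\<epsilon> = s * a / (32 * C2)"
  have \<epsilon>: "\<epsilon> > 0" using a s C2 by (simp add: \<epsilon>_def)
  obtain R0 where R0: "\<And>R. R \<ge> R0 \<Longrightarrow> integral (slab R) field_sq \<le> \<epsilon> * R\<^sup>2"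
    using decay[OF \<epsilon>] by blast
  define R where "R = max (max R0 (2 * r)) (192 * \<bar>pressure_bound\<bar> / a)"
  have R: "R \<ge> R0" "R \<ge> 2 * r" "R \<ge> 192 * \<bar>pressure_bound\<bar> / a" "R \<ge> 1" "R > 0"
    using r by (auto simp: R_def)
  have "a \<le> integral (slab (R / 2)) energy"
    unfolding a_def using R(2) by (intro integral_slab_subset_le continuous_energy energy_nonneg) auto
  then have "a / 8 \<le> integral (slab R) (\<lambda>x. cutoff 3 R x * energy x)"
    using integral_cutoff_ge[OF continuous_energy energy_nonneg R(4), of 3]
    by (simp add: eval_nat_numeral)
  also have "\<dots> \<le> s * C1 + C2 / s * (integral (slab R) field_sq / R\<^sup>2) + 6 * pressure_bound / R"
    using energy_estimate[OF R(4) s] by (simp add: C1_def C2_def)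
  also have "\<dots> \<le> a / 32 + a / 32 + a / 32"
  proof (intro add_mono)
    have "s * C1 \<le> s * (C1 + 1)" using s by simp
    also have "\<dots> = a / 32" unfolding s_def using C1 by (intro nonzero_eq_divide_eq[THEN iffD1] refl) simp
    finally show "s * C1 \<le> a / 32" .
    have "integral (slab R) field_sq / R\<^sup>2 \<le> \<epsilon>"
      using R0[OF R(1)] R(5) by (simp add: divide_le_eq)
    then have "C2 / s * (integral (slab R) field_sq / R\<^sup>2) \<le> C2 / s * \<epsilon>"
      using C2 s by (intro mult_left_mono) auto
    also have "\<dots> = a / 32" using s C2 by (simp add: \<epsilon>_def)
    finally show "C2 / s * (integral (slab R) field_sq / R\<^sup>2) \<le> a / 32" .
    have "192 * \<bar>pressure_bound\<bar> \<le> a * R" using R(3) a by (simp add: field_simps)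
    then show "6 * pressure_bound / R \<le> a / 32" using R(5) by (simp add: divide_le_eq field_simps)
  qed
  finally show False using a by simp
qed

end

section \<open>Behaviour at horizontal infinity\<close>

lemma radius_ge_outside_slab:
  assumes "x \<in> cell" "x \<notin> slab \<rho>"
  shows "\<rho> \<le> radius x"
proof -
  have "\<bar>x $ 1\<bar> \<le> radius x" "\<bar>x $ 2\<bar> \<le> radius x"
    by (simp_all add: radius_def)
  then show ?thesis using assms by (auto simp: mem_slab cell_def)
qed

lemma horizontal_decayD:
  fixes v :: "real^3 \<Rightarrow> real^3"
  assumes "((\<lambda>x. norm (v x)) \<longlongrightarrow> 0) horizontal_infinity" "\<epsilon> > 0"
  obtains \<rho> where "\<And>x. \<rho> \<le> radius x \<Longrightarrow> norm (v x) < \<epsilon>"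
proof -
  have "\<forall>\<^sub>F x in horizontal_infinity. norm (v x) < \<epsilon>"
    using order_tendstoD(2)[OF assms] .
  then show ?thesis
    using that unfolding horizontal_infinity_def eventually_filtercomap eventually_at_top_linorder
    by metis
qed

lemma bounded_on_cell:
  fixes v :: "real^3 \<Rightarrow> real^3"
  assumes v: "smooth v" and decay: "((\<lambda>x. norm (v x)) \<longlongrightarrow> 0) horizontal_infinity"
  obtains B where "\<And>x. x \<in> cell \<Longrightarrow> (norm (v x))\<^sup>2 \<le> B"
proof -
  obtain \<rho> where \<rho>: "\<And>x. \<rho> \<le> radius x \<Longrightarrow> norm (v x) < 1"
    using horizontal_decayD[OF decay, of 1] by auto
  have "compact (v ` slab \<rho>)"
    unfolding slab_def
    by (intro compact_continuous_image compact_cbox continuous_on_subset[OF smooth_continuous[OF v]]) simp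
  then obtain b where b: "\<And>x. x \<in> slab \<rho> \<Longrightarrow> norm (v x) \<le> b"
    using compact_imp_bounded bounded_iff by (metis imageI)
  have "(norm (v x))\<^sup>2 \<le> (max 1 b)\<^sup>2" if "x \<in> cell" for x
  proof (rule power_mono)
    show "norm (v x) \<le> max 1 b"
      using radius_ge_outside_slab[OF that, of \<rho>] \<rho>[of x] b[of x] by (cases "x \<in> slab \<rho>") auto
  qed simp
  then show ?thesis using that by blast
qed

text \<open>
  Outside a fixed slab the function is small, and the fixed slab contributes a bounded amount to an
  integral compared with \<open>R\<^sup>2\<close>.
\<close>

lemma slab_average_vanishes:
  fixes f :: "real^3 \<Rightarrow> real"
  assumes f: "continuous_on UNIV f" and nonneg: "\<And>x. 0 \<le> f x" and B: "\<And>x. x \<in> cell \<Longrightarrow> f x \<le> B"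
    and decay: "\<And>\<epsilon>. \<epsilon> > 0 \<Longrightarrow> \<exists>\<rho>. \<forall>x. \<rho> \<le> radius x \<longrightarrow> f x \<le> \<epsilon>"
    and \<epsilon>: "\<epsilon> > 0"
  shows "\<exists>R0. \<forall>R\<ge>R0. integral (slab R) f \<le> \<epsilon> * R\<^sup>2"
proof -
  have B0: "0 \<le> B" using B[of 0] nonneg[of 0] by (auto simp: cell_def)
  define \<eta> where "\<eta> = \<epsilon> / (16 * pi)"
  have "\<eta> > 0" using \<epsilon> by (simp add: \<eta>_def)
  then obtain \<rho>0 where \<rho>0: "\<And>x. \<rho>0 \<le> radius x \<Longrightarrow> f x \<le> \<eta>" using decay by blast
  define \<rho> where "\<rho> = max 0 \<rho>0"
  have \<rho>: "0 \<le> \<rho>" "\<And>x. \<rho> \<le> radius x \<Longrightarrow> f x \<le> \<eta>" using \<rho>0 by (auto simp: \<rho>_def)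
  show ?thesis
  proof (intro exI allI impI)
    fix R assume "max (max 1 \<rho>) (16 * pi * \<rho>\<^sup>2 * B / \<epsilon>) \<le> R"
    then have R: "1 \<le> R" "\<rho> \<le> R" "16 * pi * \<rho>\<^sup>2 * B / \<epsilon> \<le> R" by auto
    have sub: "slab \<rho> \<subseteq> slab R" using R(2) by (auto simp: mem_slab)
    have "((\<lambda>x. B) has_integral 8 * pi * \<rho>\<^sup>2 * B) (slab \<rho>)"
      using integrable_integral[OF integrable_slab[of "\<lambda>x. B" \<rho>]] integral_slab_const[OF \<rho>(1), of B]
      by simp
    then have I: "((\<lambda>x. if x \<in> slab \<rho> then B else 0) has_integral 8 * pi * \<rho>\<^sup>2 * B) (slab R)"
      by (simp only: has_integral_restrict[OF sub])
    have J: "((\<lambda>x. \<eta>) has_integral 8 * pi * R\<^sup>2 * \<eta>) (slab R)"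
      using integrable_integral[OF integrable_slab[of "\<lambda>x. \<eta>" R]] integral_slab_const[of R \<eta>] R(1)
      by simp
    have "integral (slab R) f \<le> 8 * pi * R\<^sup>2 * \<eta> + 8 * pi * \<rho>\<^sup>2 * B"
    proof (rule has_integral_le[OF integrable_integral[OF integrable_slab[OF f]] has_integral_add[OF J I]])
      fix x assume "x \<in> slab R"
      then have "x \<in> cell" using slab_subset_cell by blast
      then show "f x \<le> \<eta> + (if x \<in> slab \<rho> then B else 0)"
        using B[of x] \<rho>(2)[of x] radius_ge_outside_slab[of x \<rho>] \<open>\<eta> > 0\<close> by auto
    qed
    also have "8 * pi * R\<^sup>2 * \<eta> = \<epsilon> * R\<^sup>2 / 2" by (simp add: \<eta>_def)
    also have "8 * pi * \<rho>\<^sup>2 * B \<le> \<epsilon> * R\<^sup>2 / 2"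
    proof -
      have "16 * pi * \<rho>\<^sup>2 * B \<le> \<epsilon> * R" using R(3) \<epsilon> by (simp add: field_simps)
      also have "\<dots> \<le> \<epsilon> * R\<^sup>2"
        using R(1) \<epsilon> by (intro mult_left_mono) (auto simp: power2_eq_square)
      finally show ?thesis by simp
    qed
    finally show "integral (slab R) f \<le> \<epsilon> * R\<^sup>2" by simp
  qed
qed

lemma integral_slab_le_dirichlet:
  assumes v: "smooth v" and fin: "dirichlet_integral v < \<infinity>"
  shows "integral (slab R) (grad_sq v) \<le> enn2real (dirichlet_integral v)"
proof -
  let ?I = "\<integral>\<^sup>+x\<in>slab R. ennreal (grad_sq v x) \<partial>lborel"
  have le: "?I \<le> dirichlet_integral v"
    unfolding dirichlet_integral_def grad_sq_def[symmetric]
    using slab_subset_cell[of R] by (intro nn_integral_mono) (auto simp: indicator_def)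
  have "set_borel_measurable borel (slab R) (grad_sq v)"
    unfolding set_borel_measurable_def
    using borel_measurable_continuous_onI[OF continuous_grad_sq[OF v]]
    by (intro borel_measurable_scaleR borel_measurable_indicator) (auto simp: slab_def)
  then have eq: "?I = ennreal (integral (slab R) (grad_sq v))"
    using le fin by (intro set_nn_integral_lborel_eq_integral) (auto simp: grad_sq_nonneg)
  have "0 \<le> integral (slab R) (grad_sq v)"
    by (intro integral_nonneg integrable_slab continuous_grad_sq v grad_sq_nonneg)
  then show ?thesis
    using enn2real_mono[OF le] fin by (simp add: eq)
qed

lemma periodic_z_shift:
  assumes "periodic_z f"
  shows "f (x + axis 3 (2 * pi * of_int m)) = f x"
proof (induction m rule: int_induct[where k = 0])
  case base
  then show ?case by (simp add: axis_def vec_eq_iff zero_vec_def[symmetric])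
next
  case (step1 i)
  have "x + axis 3 (2 * pi * of_int (i + 1)) = (x + axis 3 (2 * pi * of_int i)) + axis 3 (2 * pi)"
    by (simp add: vec_eq_iff axis_def algebra_simps)
  then show ?case using assms step1.IH by (simp only: periodic_z_def)
next
  case (step2 i)
  have "x + axis 3 (2 * pi * of_int i) = (x + axis 3 (2 * pi * of_int (i - 1))) + axis 3 (2 * pi)"
    by (simp add: vec_eq_iff axis_def algebra_simps)
  then show ?case using assms step2.IH by (metis periodic_z_def)
qed

lemma periodic_z_representative:
  assumes "periodic_z f"
  obtains y where "y \<in> cell" "f y = f x"
proof -
  define m where "m = \<lfloor>(x $ 3 + pi) / (2 * pi)\<rfloor>"
  define y where "y = x + axis 3 (2 * pi * of_int (- m))"
  have "of_int m \<le> (x $ 3 + pi) / (2 * pi)" "(x $ 3 + pi) / (2 * pi) < of_int m + 1"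
    unfolding m_def by linarith+
  then have "of_int m * (2 * pi) \<le> x $ 3 + pi" "x $ 3 + pi < (of_int m + 1) * (2 * pi)"
    by (simp_all add: pos_le_divide_eq pos_divide_less_eq)
  then have "y \<in> cell"
    by (simp add: cell_def y_def axis_def algebra_simps)
  moreover have "f y = f x" unfolding y_def by (rule periodic_z_shift[OF assms])
  ultimately show ?thesis by (rule that)
qed

text \<open>
  By periodicity it is enough to consider the cell; there the field is constant along the
  horizontal line through the point, on which it tends to zero.
\<close>

lemma zero_of_zero_gradient:
  fixes v :: "real^3 \<Rightarrow> real^3"
  assumes v: "smooth v" and per: "periodic_z v"
    and decay: "((\<lambda>x. norm (v x)) \<longlongrightarrow> 0) horizontal_infinity"
    and grad: "\<And>x. x \<in> cell \<Longrightarrow> grad_sq v x = 0"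
  shows "v x = 0"
proof -
  obtain y where y: "y \<in> cell" "v y = v x" using periodic_z_representative[OF per] by blast
  have shift: "v (y + t *\<^sub>R axis 1 1) = v y" for t
  proof -
    have "partial 1 v (y + t *\<^sub>R axis 1 1) = 0" for t
    proof -
      have "y + t *\<^sub>R axis 1 1 \<in> cell" using y(1) by (simp add: cell_def axis_def)
      then show ?thesis using norm_partial_sq_le[of 1 v "y + t *\<^sub>R axis 1 1"] grad by simp
    qed
    then have "((\<lambda>t. v (y + t *\<^sub>R axis 1 1) $ k) has_real_derivative 0) (at t)" for t k
      using has_partial_along_line[OF has_partial_component[OF v, of 1 k], of y t] by simp
    then have "v (y + t *\<^sub>R axis 1 1) $ k = v (y + 0 *\<^sub>R axis 1 1) $ k" for k
      using DERIV_isconst_all[of "\<lambda>t. v (y + t *\<^sub>R axis 1 1) $ k" t 0] by blast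
    then show ?thesis by (simp add: vec_eq_iff)
  qed
  have "norm (v y) \<le> 0 + \<epsilon>" if \<epsilon>: "\<epsilon> > 0" for \<epsilon>
  proof -
    obtain \<rho> where \<rho>: "\<And>x. \<rho> \<le> radius x \<Longrightarrow> norm (v x) < \<epsilon>"
      using horizontal_decayD[OF decay \<epsilon>] by blast
    define z where "z = y + (\<rho> - y $ 1) *\<^sub>R axis 1 1"
    have "z $ 1 = \<rho>" by (simp add: z_def axis_def)
    then have "\<rho> \<le> radius z" using real_sqrt_ge_abs1[of "z $ 1" "z $ 2"] by (simp add: radius_def)
    then show ?thesis using \<rho>[of z] shift[of "\<rho> - y $ 1"] by (simp add: z_def)
  qed
  then have "norm (v y) \<le> 0" by (rule field_le_epsilon)
  then show ?thesis using y by simp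
qed

lemma zero_on_cell_of_zero_integrals:
  fixes f :: "real^3 \<Rightarrow> real"
  assumes f: "continuous_on UNIV f" "\<And>x. 0 \<le> f x"
    and zero: "\<And>r. r \<ge> 1 \<Longrightarrow> integral (slab r) f = 0" and x: "x \<in> cell"
  shows "f x = 0"
proof -
  define r where "r = max 1 (max \<bar>x $ 1\<bar> \<bar>x $ 2\<bar>)"
  have "(0::real^3) \<in> box (vector [-r, -r, -pi]) (vector [r, r, pi])"
    by (simp add: mem_box_cart forall_3 r_def)
  moreover have "x \<in> slab r" using x by (auto simp: mem_slab cell_def r_def)
  moreover have "integral (slab r) f = 0" by (rule zero) (simp add: r_def)
  ultimately show ?thesis
    using integral_cbox_eq_0_iff[of "vector [-r, -r, -pi] :: real^3" "vector [r, r, pi]" f] f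
      continuous_on_subset[OF f(1)]
    unfolding slab_def by blast
qed

section \<open>The Liouville theorem\<close>

theorem corollary1p1:
  fixes u h :: "real^3 \<Rightarrow> real^3" and p :: "real^3 \<Rightarrow> real"
  assumes "smooth u" and "smooth h" and "smooth p"
    and "\<forall>x. convection u u x + gradient p x - convection h h x - laplacian u x = 0"
    and "\<forall>x. convection u h x - convection h u x - laplacian h x = 0"
    and "\<forall>x. divergence u x = 0" and "\<forall>x. divergence h x = 0"
    and "periodic_z u" and "periodic_z h"
    and "((\<lambda>x. norm (u x)) \<longlongrightarrow> 0) horizontal_infinity"
    and "((\<lambda>x. norm (h x)) \<longlongrightarrow> 0) horizontal_infinity"
    and "dirichlet_integral u + dirichlet_integral h < \<infinity>"
    and "(swirl_free u \<and> axially_symmetric h) \<or> (axially_symmetric u \<and> axially_symmetric h)"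
  shows "(\<forall>x. u x = 0) \<and> (\<forall>x. h x = 0)"
proof -
  note decay = assms(10,11)
  obtain Bu Bh where B: "\<And>x. x \<in> cell \<Longrightarrow> (norm (u x))\<^sup>2 \<le> Bu" "\<And>x. x \<in> cell \<Longrightarrow> (norm (h x))\<^sup>2 \<le> Bh"
    using bounded_on_cell[OF assms(1) decay(1)] bounded_on_cell[OF assms(2) decay(2)] by metis
  define M where "M = max Bu Bh"
  define E where "E = max (enn2real (dirichlet_integral u)) (enn2real (dirichlet_integral h))"
  have fin: "dirichlet_integral u < \<infinity>" "dirichlet_integral h < \<infinity>"
    using assms(12) by (auto simp: less_top[symmetric])
  have swirl: "swirl_invariant u" "swirl_invariant h"
    using assms(1,2,13) swirl_invariant_of_swirl_free swirl_invariant_of_axially_symmetric by blast+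
  interpret mhd_solution u h M E p
  proof
    show "(norm (u x))\<^sup>2 \<le> M" "(norm (h x))\<^sup>2 \<le> M" if "x \<in> cell" for x
      using B[OF that] by (auto simp: M_def)
    show "integral (slab R) (grad_sq u) \<le> E" "integral (slab R) (grad_sq h) \<le> E" for R
      using integral_slab_le_dirichlet[OF assms(1) fin(1), of R]
        integral_slab_le_dirichlet[OF assms(2) fin(2), of R] by (auto simp: E_def)
  qed (use assms swirl in auto)
  have small: "\<exists>\<rho>. \<forall>x. \<rho> \<le> radius x \<longrightarrow> field_sq x \<le> \<epsilon>" if \<epsilon>: "\<epsilon> > 0" for \<epsilon>
  proof -
    have s: "sqrt (\<epsilon> / 2) > 0" using \<epsilon> by simp
    obtain \<rho>1 where 1: "\<And>x. \<rho>1 \<le> radius x \<Longrightarrow> norm (u x) < sqrt (\<epsilon> / 2)"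
      using horizontal_decayD[OF decay(1) s] by blast
    obtain \<rho>2 where 2: "\<And>x. \<rho>2 \<le> radius x \<Longrightarrow> norm (h x) < sqrt (\<epsilon> / 2)"
      using horizontal_decayD[OF decay(2) s] by blast
    have "field_sq x \<le> \<epsilon>" if "max \<rho>1 \<rho>2 \<le> radius x" for x
    proof -
      have "(norm (u x))\<^sup>2 \<le> (sqrt (\<epsilon> / 2))\<^sup>2" "(norm (h x))\<^sup>2 \<le> (sqrt (\<epsilon> / 2))\<^sup>2"
        using 1[of x] 2[of x] that by (auto intro!: power_mono)
      then show ?thesis using \<epsilon> by (simp add: field_sq_def)
    qed
    then show ?thesis by blast
  qed
  have "energy x = 0" if "x \<in> cell" for x
  proof (rule zero_on_cell_of_zero_integrals[OF continuous_energy energy_nonneg _ that])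
    show "integral (slab r) energy = 0" if "r \<ge> 1" for r
      using slab_average_vanishes[OF continuous_field_sq field_sq_nonneg field_sq_le small]
      by (rule energy_vanishes[OF _ that])
  qed
  then have "grad_sq u x + grad_sq h x = 0" if "x \<in> cell" for x
    using that by (simp add: energy_def)
  then have "grad_sq u x = 0" "grad_sq h x = 0" if "x \<in> cell" for x
    using that by (simp_all add: add_nonneg_eq_0_iff grad_sq_nonneg)
  then show ?thesis
    using zero_of_zero_gradient[OF assms(1,8) decay(1)] zero_of_zero_gradient[OF assms(2,9) decay(2)]
    by blast
qed

end
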